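(* Assume $\sup_{t\in\mathcal{T}}\|A_t\|_2\le 1$ and $\beta>4\sigma^2$. If for every $t\in\mathcal{T}$ \[\mathrm{pen}(t)\ge\frac{4\sigma^2}{\beta-4\sigma^2}\Big(\sigma^2\mathrm{Tr}(A_t^2)+2\big[\widetilde{\|f_0-b\|}_\infty^2\mathrm{Tr}(A_t^2)+\|b_t\|_2^2\big]\Big),\] then: (i) for any $\eta\in(0,1]$, with probability at least $1-\eta$, \[\|f_0-f_{EWA}\|_2^2\le\inf_{\mu\in\mathcal{M}_+^1(\mathcal{T})}\Big\{\int\|f_0-\hat f_t\|_2^2\,d\mu(t)+\int\Big(\mathrm{pen}(t)+2\sigma^2\mathrm{Tr}(A_t)+\frac{8\sigma^2}{\beta-4\sigma^2}\big[\widetilde{\|f_0-b\|}_\infty^2\mathrm{Tr}(A_t^2)+\|b_t\|_2^2\big]\Big)d\mu(t)+\beta\Big(2\,\mathrm{KL}(\mu,\pi)+\ln\frac1\eta\Big)\Big\};\] (ii) furthermore, \[\mathbb{E}\|f_0-f_{EWA}\|_2^2\le\inf_{\mu\in\mathcal{M}_+^1(\mathcal{T})}\Big\{\int\mathbb{E}\|f_0-\hat f_t\|_2^2\,d\mu(t)+\int\Big(\mathrm{pen}(t)+2\sigma^2\mathrm{Tr}(A_t)+\frac{8\sigma^2}{\beta-4\sigma^2}\big[\widetilde{\|f_0-b\|}_\infty^2\mathrm{Tr}(A_t^2)+\|b_t\|_2^2\big]\Big)d\mu(t)+2\beta\,\mathrm{KL}(\mu,\pi)\Big\}.\]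
   Context: Model: one observes $Y=f_0+W\in\mathbb{R}^n$, i.e. $Y_i=f_0(x_i)+W_i$ at fixed design points $x_1,\dots,x_n$; the unknown function $f_0$ is identified with the deterministic vector $(f_0(x_i))_{i=1}^n\in\mathbb{R}^n$. The noise $W$ is a random vector in $\mathbb{R}^n$ (coordinates not assumed independent) with $\mathbb{E}(W)=0$ and, for a known $\sigma^2\ge0$, $\mathbb{E}[\exp(\alpha^\top W)]\le\exp(\frac{\sigma^2}{2}\|\alpha\|_2^2)$ for all $\alpha\in\mathbb{R}^n$. For vectors $\|\cdot\|_2$ is the Euclidean norm; for matrices $\|\cdot\|_2$ is the operator (spectral) norm. Estimators: $\mathcal{T}$ is a measurable space (not necessarily countable). For $t\in\mathcal{T}$, $A_t$ is a (deterministic) real symmetric positive semi-definite $n\times n$ matrix, $b_t\in\mathbb{R}^n$, and $b\in\mathbb{R}^n$ is a fixed common recentring vector; $\hat f_t=\hat f_t(Y)=A_t(Y-b)+b+b_t$. $\widetilde{\|f_0-b\|}_\infty$ denotes the smallest real $C\ge0$ such that $\|A_t(f_0-b)\|_2^2\le C^2\,\mathrm{Tr}(A_t^2)$ for all $t\in\mathcal{T}$. Aggregate: $\mathrm{pen}:\mathcal{T}\to\mathbb{R}$ is a deterministic penalty, $\pi$ a prior probability measure on $\mathcal{T}$, $\beta>0$ the temperature. The maps $t\mapsto A_t,b_t,\mathrm{pen}(t)$ are measurable. Set $r_t=\|Y-\hat f_t(Y)\|_2^2+2\sigma^2\mathrm{Tr}(A_t)-n\sigma^2$ and $\widetilde r_t=r_t+\mathrm{pen}(t)$.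 Define the probability measure $d\rho_{EWA}(t)=\frac{\exp(-\widetilde r_t/\beta)}{\int\exp(-\widetilde r_{t'}/\beta)\,d\pi(t')}\,d\pi(t)$ and the exponentially weighted aggregate $f_{EWA}=\int\hat f_t\,d\rho_{EWA}(t)$. $\mathcal{M}_+^1(\mathcal{T})$ is the set of probability measures on $\mathcal{T}$; $\mathrm{KL}(\mu,\pi)$ is the Kullback–Leibler divergence, $\int\ln\frac{d\mu}{d\pi}\,d\mu$ if $\mu\ll\pi$ and $+\infty$ otherwise. *)

theory Defs
  imports "HOL-Probability.Probability"
begin

definition psd_matrix :: "real^'n^'n \<Rightarrow> bool" where
  "psd_matrix A \<longleftrightarrow> transpose A = A \<and> (\<forall>x. 0 \<le> x \<bullet> (A *v x))"

(* The exponential moment is an extended integral, so the bound includes its finiteness. *)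
definition centred_subgaussian ::
    "'w measure \<Rightarrow> ('w \<Rightarrow> 'a::euclidean_space) \<Rightarrow> real \<Rightarrow> bool" where
  "centred_subgaussian P W \<sigma> \<longleftrightarrow>
     W \<in> borel_measurable P \<and>
     integrable P W \<and> (\<integral>\<omega>. W \<omega> \<partial>P) = 0 \<and>
     (\<forall>\<alpha>. (\<integral>\<^sup>+\<omega>. ennreal (exp (\<alpha> \<bullet> W \<omega>)) \<partial>P) \<le> ennreal (exp (\<sigma>\<^sup>2 / 2 * (norm \<alpha>)\<^sup>2)))"

definition affine_estimator ::
    "('t \<Rightarrow> real^'n^'n) \<Rightarrow> real^'n \<Rightarrow> ('t \<Rightarrow> real^'n) \<Rightarrow> 't \<Rightarrow> real^'n \<Rightarrow> real^'n" where
  "affine_estimator A b bt t y = A t *v (y - b) + b + bt t"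

(* The minimum exists for positive semidefinite A t: C = norm v is admissible because the
   Frobenius norm dominates the operator norm, and the set of admissible C is closed. *)
definition modified_sup_norm :: "'t set \<Rightarrow> ('t \<Rightarrow> real^'n^'n) \<Rightarrow> real^'n \<Rightarrow> real" where
  "modified_sup_norm T A v =
     (LEAST C. 0 \<le> C \<and> (\<forall>t\<in>T. (norm (A t *v v))\<^sup>2 \<le> C\<^sup>2 * trace (A t ** A t)))"

definition bias_term ::
    "'t set \<Rightarrow> ('t \<Rightarrow> real^'n^'n) \<Rightarrow> real^'n \<Rightarrow> ('t \<Rightarrow> real^'n) \<Rightarrow> real^'n \<Rightarrow> 't \<Rightarrow> real" where
  "bias_term T A b bt f0 t =
     (modified_sup_norm T A (f0 - b))\<^sup>2 * trace (A t ** A t) + (norm (bt t))\<^sup>2"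

definition risk_estimate ::
    "real \<Rightarrow> ('t \<Rightarrow> real^'n^'n) \<Rightarrow> real^'n \<Rightarrow> ('t \<Rightarrow> real^'n) \<Rightarrow> real^'n \<Rightarrow> 't \<Rightarrow> real" where
  "risk_estimate \<sigma> A b bt y t =
     (norm (y - affine_estimator A b bt t y))\<^sup>2 + 2 * \<sigma>\<^sup>2 * trace (A t) - real CARD('n) * \<sigma>\<^sup>2"

definition penalized_risk ::
    "real \<Rightarrow> ('t \<Rightarrow> real^'n^'n) \<Rightarrow> real^'n \<Rightarrow> ('t \<Rightarrow> real^'n) \<Rightarrow> ('t \<Rightarrow> real) \<Rightarrow> real^'n \<Rightarrow> 't \<Rightarrow> real"
  where
  "penalized_risk \<sigma> A b bt pen y t = risk_estimate \<sigma> A b bt y t + pen t"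

definition EWA_measure ::
    "real \<Rightarrow> real \<Rightarrow> 't measure \<Rightarrow> ('t \<Rightarrow> real^'n^'n) \<Rightarrow> real^'n \<Rightarrow> ('t \<Rightarrow> real^'n) \<Rightarrow>
     ('t \<Rightarrow> real) \<Rightarrow> real^'n \<Rightarrow> 't measure" where
  "EWA_measure \<sigma> \<beta> \<pi> A b bt pen y =
     density \<pi> (\<lambda>t. ennreal (exp (- penalized_risk \<sigma> A b bt pen y t / \<beta>) /
       (\<integral>t'. exp (- penalized_risk \<sigma> A b bt pen y t' / \<beta>) \<partial>\<pi>)))"

definition f_EWA ::
    "real \<Rightarrow> real \<Rightarrow> 't measure \<Rightarrow> ('t \<Rightarrow> real^'n^'n) \<Rightarrow> real^'n \<Rightarrow> ('t \<Rightarrow> real^'n) \<Rightarrow>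
     ('t \<Rightarrow> real) \<Rightarrow> real^'n \<Rightarrow> real^'n" where
  "f_EWA \<sigma> \<beta> \<pi> A b bt pen y =
     (\<integral>t. affine_estimator A b bt t y \<partial>EWA_measure \<sigma> \<beta> \<pi> A b bt pen y)"

(* KL_divergence takes the reference measure as its first measure argument, and is a Bochner
   integral, hence 0 when the log-density is not integrable. The negative part of the log-density
   is always mu-integrable, so non-integrability means the divergence is infinite.
   For probability measures the divergence is nonnegative, so ennreal does not truncate. *)
definition KL :: "'t measure \<Rightarrow> 't measure \<Rightarrow> ennreal" where
  "KL \<mu> \<pi> =
     (if absolutely_continuous \<pi> \<mu> \<and> integrable \<mu> (entropy_density (exp 1) \<pi> \<mu>)
      then ennreal (KL_divergence (exp 1) \<pi> \<mu>) else \<infinity>)"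

end

theory Submission
  imports Defs
begin

text \<open>
  Write \<open>loss\<close> for the squared error of the estimator \<open>t\<close>, \<open>risk\<close> for its penalised risk and
  \<open>W\<close> for the noise.  Up to a term that does not depend on \<open>t\<close>, the loss equals the risk plus
  \<open>\<beta> * aggregation_excess\<close>, where the excess collects a linear and a quadratic form of \<open>W\<close> and
  the negative penalty.  The exponential weights minimise the mean risk plus \<open>\<beta>\<close> times the divergence
  from \<open>\<pi>\<close>, so the loss of the aggregate is at most the mean loss under any competitor \<open>\<mu>\<close>
  plus divergences, plus the mean excess under the weights minus the mean excess under \<open>\<mu>\<close>.
  Both means depend on data-driven or arbitrary measures; the Gibbs variational principle trades
  each of them for a divergence and the logarithm of an exponential average under the fixed prior
  \<open>\<pi>\<close>.  Here the same principle is used in integrated form: Jensen's inequality for the weights and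
  the Cauchy-Schwarz inequality for the competitor give the deterministic bound
  \<open>exp (norm (f0 - ewa w) ^ 2 / \<beta>) * (partition_function w)\<^sup>2 \<le> deviation w\<close>
  (\<open>exp_ewa_loss_le_deviation\<close>), and \<open>- 2 * \<beta> * ln (partition_function w)\<close> is the infimum over \<open>\<mu>\<close> on the
  right-hand side of the oracle inequality (\<open>gibbs_variational_inequality\<close>,
  \<open>gibbs_variational_attained\<close>).  That the infimum is attained also shows that it is a measurable
  function of the noise, so that the event in the first claim is measurable.

  It remains to show that the deviation has expectation at most 1 (\<open>expected_deviation_le_1\<close>).
  By Tonelli's theorem this is a statement about a single pair \<open>(t, s)\<close>: the exponential moment of a
  linear plus a quadratic form of a sub-Gaussian vector with possibly dependent coordinates
  (\<open>subgaussian_exp_quadratic_form\<close>).  In an eigenbasis of \<open>A t\<close> the quadratic form is a sum of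
  squares, each of which becomes linear after averaging over an auxiliary standard normal variable;
  the resulting bound is the value for a Gaussian vector.  Its first-order trace is cancelled by
  \<open>2 * \<sigma>\<^sup>2 * trace (A t)\<close> in the risk estimate, and the remainder is what the lower bound on the penalty and the
  additional price on the right-hand side are designed to absorb.

  Given the moment bound, Markov's inequality yields the claim in probability, and
  \<open>1 + x \<le> exp x\<close> yields the claim in expectation.
\<close>

section \<open>Spectral theorem for symmetric matrices\<close>

text \<open>A maximiser of the quadratic form \<open>z \<bullet> f z\<close> on the unit sphere of \<open>S\<close> is critical:
  moving from \<open>x\<close> in a direction \<open>y\<close> orthogonal to \<open>x\<close> changes the form to first order by
  \<open>2 * (y \<bullet> f x)\<close>, which must vanish.  Hence the part of \<open>f x\<close> that is orthogonal to \<open>x\<close> is zero.\<close>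

lemma selfadjoint_eigenvector_exists:
  fixes f :: "'a::euclidean_space \<Rightarrow> 'a"
  assumes "linear f" and sa: "\<And>x y. f x \<bullet> y = x \<bullet> f y"
    and S: "subspace S" and inv: "f ` S \<subseteq> S" and "S \<noteq> {0}"
  obtains x c where "x \<in> S" "norm x = 1" "f x = c *\<^sub>R x"
proof -
  interpret f: linear f by fact
  have cont: "continuous_on K f" for K
    by (simp add: linear_continuous_on linear_linear \<open>linear f\<close>)
  have "compact (S \<inter> sphere 0 1)"
    using closed_subspace[OF S] by (simp add: closed_Int_compact)
  moreover have "S \<inter> sphere 0 1 \<noteq> {}"
  proof -
    obtain z where z: "z \<in> S" "z \<noteq> 0"
      using \<open>S \<noteq> {0}\<close> subspace_0[OF S] by blast
    then have "(1 / norm z) *\<^sub>R z \<in> S \<inter> sphere 0 1"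
      using S by (auto simp: subspace_scale)
    then show ?thesis by blast
  qed
  moreover have "continuous_on (S \<inter> sphere 0 1) (\<lambda>z. z \<bullet> f z)"
    by (intro continuous_intros cont)
  ultimately obtain x where x: "x \<in> S" "norm x = 1"
    and max: "\<And>z. z \<in> S \<Longrightarrow> norm z = 1 \<Longrightarrow> z \<bullet> f z \<le> x \<bullet> f x"
    using continuous_attains_sup[of "S \<inter> sphere 0 1" "\<lambda>z. z \<bullet> f z"]
    by (metis Int_iff mem_sphere_0)
  define l where "l = x \<bullet> f x"
  have form: "z \<bullet> f z \<le> l * (z \<bullet> z)" if "z \<in> S" for z
  proof (cases "z = 0")
    case False
    define u where "u = (1 / norm z) *\<^sub>R z"
    have "u \<in> S" "norm u = 1" and z: "z = norm z *\<^sub>R u"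
      using that False S by (auto simp: u_def subspace_scale)
    then have "(norm z)\<^sup>2 * (u \<bullet> f u) \<le> (norm z)\<^sup>2 * l"
      by (intro mult_left_mono) (auto simp: l_def max)
    moreover have "z \<bullet> f z = (norm z)\<^sup>2 * (u \<bullet> f u)"
      by (subst (1 2) z) (simp add: f.scale power2_eq_square)
    ultimately show ?thesis by (simp add: power2_norm_eq_inner mult.commute)
  qed (simp add: f.zero)
  have orth: "y \<bullet> f x = 0" if y: "y \<in> S" "x \<bullet> y = 0" for y
  proof -
    define c where "c = y \<bullet> f x"
    define K where "K = \<bar>l * (y \<bullet> y) - y \<bullet> f y\<bar> + 1"
    have K: "K > 0" "l * (y \<bullet> y) - y \<bullet> f y \<le> K" by (auto simp: K_def)
    have xx: "x \<bullet> x = 1" using x(2) by (simp add: norm_eq_1)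
    have "x \<bullet> f y = c" using sa[of x y] by (simp add: c_def inner_commute)
    have first_order: "2 * t * c \<le> t\<^sup>2 * K" for t
    proof -
      have "x + t *\<^sub>R y \<in> S" using x y S by (simp add: subspace_add subspace_scale)
      from form[OF this]
      have "l + 2 * t * c + t\<^sup>2 * (y \<bullet> f y) \<le> l * (1 + t\<^sup>2 * (y \<bullet> y))"
        using xx y(2) \<open>x \<bullet> f y = c\<close> unfolding c_def l_def
        by (simp add: f.add f.scale inner_add_left inner_add_right inner_commute
            power2_eq_square algebra_simps)
      then have "2 * t * c \<le> t\<^sup>2 * (l * (y \<bullet> y) - y \<bullet> f y)" by (simp add: algebra_simps)
      also have "\<dots> \<le> t\<^sup>2 * K" using K by (intro mult_left_mono) auto
      finally show ?thesis .
    qed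
    \<comment> \<open>The choice of \<open>t\<close> minimises \<open>t\<^sup>2 * K - 2 * t * c\<close>.\<close>
    have "2 * (c / K) * c \<le> (c / K)\<^sup>2 * K" by (rule first_order)
    then have "2 * c\<^sup>2 / K \<le> c\<^sup>2 / K" using K by (simp add: power2_eq_square field_simps)
    then have "c\<^sup>2 \<le> 0" using K by (simp add: field_simps)
    then show ?thesis by (simp add: c_def)
  qed
  have "f x - l *\<^sub>R x \<in> S"
    using x inv S by (auto intro!: subspace_diff subspace_scale)
  moreover have "x \<bullet> (f x - l *\<^sub>R x) = 0"
    using x(2) by (simp add: l_def inner_diff_right norm_eq_1)
  ultimately have "(f x - l *\<^sub>R x) \<bullet> f x = 0" "(f x - l *\<^sub>R x) \<bullet> x = 0"
    using orth by (metis, metis inner_commute)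
  then have "(f x - l *\<^sub>R x) \<bullet> (f x - l *\<^sub>R x) = 0"
    by (subst inner_diff_right) simp
  then have "f x = l *\<^sub>R x" by simp
  with x that show ?thesis by blast
qed

lemma selfadjoint_orthonormal_eigenbasis_of_subspace:
  fixes f :: "'a::euclidean_space \<Rightarrow> 'a"
  assumes "linear f" and sa: "\<And>x y. f x \<bullet> y = x \<bullet> f y"
  shows "subspace S \<Longrightarrow> f ` S \<subseteq> S \<Longrightarrow>
    \<exists>B. B \<subseteq> S \<and> pairwise orthogonal B \<and> (\<forall>e\<in>B. norm e = 1 \<and> (\<exists>c. f e = c *\<^sub>R e)) \<and> span B = S"
proof (induction "dim S" arbitrary: S rule: less_induct)
  case less
  interpret f: linear f by fact
  show ?case
  proof (cases "S = {0}")
    case True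
    then show ?thesis by (intro exI[of _ "{}"]) auto
  next
    case False
    then obtain x c where x: "x \<in> S" "norm x = 1" "f x = c *\<^sub>R x"
      using selfadjoint_eigenvector_exists[OF \<open>linear f\<close> sa less.prems] by blast
    define S' where "S' = S \<inter> {y. x \<bullet> y = 0}"
    have sub': "subspace S'"
      unfolding S'_def using less.prems(1) by (intro subspace_inter subspace_hyperplane)
    \<comment> \<open>Self-adjointness makes the orthogonal complement of an eigenvector invariant.\<close>
    have inv': "f ` S' \<subseteq> S'"
      using less.prems(2) x(3) sa[of x] by (auto simp: S'_def) (metis mult_zero_right)
    have "x \<notin> S'" using x(2) by (auto simp: S'_def)
    then have "S' \<subset> S" using x(1) unfolding S'_def by blast
    then have "dim S' < dim S"
      using sub' less.prems(1)
      by (metis dim_psubset span_eq_iff)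
    from less.hyps[OF this sub' inv'] obtain B where B: "B \<subseteq> S'" "pairwise orthogonal B"
      "\<forall>e\<in>B. norm e = 1 \<and> (\<exists>c. f e = c *\<^sub>R e)" "span B = S'" by blast
    have "span (insert x B) = S"
    proof (rule antisym)
      show "span (insert x B) \<subseteq> S"
        using B(1) x(1) less.prems(1) by (intro span_minimal) (auto simp: S'_def)
      show "S \<subseteq> span (insert x B)"
      proof
        fix z assume z: "z \<in> S"
        have "z - (x \<bullet> z) *\<^sub>R x \<in> S'"
          using z x less.prems(1)
          by (auto simp: S'_def inner_diff_right norm_eq_1 subspace_diff subspace_scale)
        then show "z \<in> span (insert x B)"
          using B(4) span_breakdown_eq[of z x B] by auto
      qed
    qed
    moreover have "pairwise orthogonal (insert x B)"
      using B(1,2) by (auto simp: pairwise_insert S'_def orthogonal_def inner_commute)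
    ultimately show ?thesis
      using B(1,3) x by (intro exI[of _ "insert x B"]) (auto simp: S'_def)
  qed
qed

lemma orthonormal_basis_expansion:
  fixes B :: "'a::euclidean_space set"
  assumes "finite B" "pairwise orthogonal B" "\<And>e. e \<in> B \<Longrightarrow> norm e = 1" "span B = UNIV"
  shows "(\<Sum>e\<in>B. (z \<bullet> e) *\<^sub>R e) = z"
proof (rule ccontr)
  define d where "d = z - (\<Sum>e\<in>B. (z \<bullet> e) *\<^sub>R e)"
  have "d \<bullet> e = 0" if "e \<in> B" for e
  proof -
    have "(\<Sum>i\<in>B. (z \<bullet> i) * (i \<bullet> e)) = (\<Sum>i\<in>B. if i = e then z \<bullet> e else 0)"
      using assms(2,3) that
      by (intro sum.cong) (auto simp: pairwise_def orthogonal_def norm_eq_1)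
    then show ?thesis
      using assms(1) that by (simp add: d_def inner_diff_left inner_sum_left)
  qed
  then have "orthogonal d d"
    using orthogonal_to_span[of d B d] assms(4) by (auto simp: orthogonal_def)
  moreover assume "(\<Sum>e\<in>B. (z \<bullet> e) *\<^sub>R e) \<noteq> z"
  ultimately show False by (simp add: d_def orthogonal_def)
qed

text \<open>The frame of eigenvectors in which the exponential moment of a quadratic form is computed.
  The identities for the traces come from the diagonal entries
  \<open>M $ i $ i = (\<Sum>e\<in>B. m e * (e $ i)\<^sup>2)\<close> of a matrix \<open>M\<close> with eigenvalues \<open>m\<close> on \<open>B\<close>;
  both \<open>A\<close> and its square are of this kind.\<close>

lemma symmetric_matrix_eigenbasis:
  fixes A :: "real^'n^'n"
  assumes sym: "transpose A = A"
  obtains B a where "finite B" "pairwise orthogonal B" "\<And>e. e \<in> B \<Longrightarrow> norm e = 1"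
    "\<And>z. (\<Sum>e\<in>B. (z \<bullet> e) *\<^sub>R e) = z" "\<And>e. e \<in> B \<Longrightarrow> A *v e = a e *\<^sub>R e"
    "trace A = sum a B" "trace (A ** A) = (\<Sum>e\<in>B. (a e)\<^sup>2)"
proof -
  have sa: "(A *v x) \<bullet> y = x \<bullet> (A *v y)" for x y
    using dot_lmul_matrix[of x A y] sym
    by (metis matrix_vector_mul_assoc transpose_matrix_vector)
  obtain B where B: "pairwise orthogonal B" "span B = UNIV"
    "\<forall>e\<in>B. norm e = 1 \<and> (\<exists>c. A *v e = c *\<^sub>R e)"
    using selfadjoint_orthonormal_eigenbasis_of_subspace
      [of "(*v) A" UNIV, OF matrix_vector_mul_linear sa] by auto
  have fin: "finite B"
    using B by (intro pairwise_orthogonal_imp_finite)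
  obtain a where a: "\<And>e. e \<in> B \<Longrightarrow> A *v e = a e *\<^sub>R e" using B(3) by metis
  have ex: "(\<Sum>e\<in>B. (z \<bullet> e) *\<^sub>R e) = z" for z
    using orthonormal_basis_expansion[OF fin] B by auto
  have tr: "trace M = (\<Sum>e\<in>B. m e)" if M: "\<And>e. e \<in> B \<Longrightarrow> M *v e = m e *\<^sub>R e"
    for M :: "real^'n^'n" and m
  proof -
    have entry: "M $ i $ i = (\<Sum>e\<in>B. m e * (e $ i)\<^sup>2)" for i
    proof -
      have "M *v axis i 1 = M *v (\<Sum>e\<in>B. (axis i 1 \<bullet> e) *\<^sub>R e)" by (simp add: ex)
      also have "\<dots> = (\<Sum>e\<in>B. (e $ i) *\<^sub>R (m e *\<^sub>R e))"
        by (simp add: linear_sum[OF matrix_vector_mul_linear] matrix_vector_mult_scaleR M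
            inner_axis' cong: sum.cong)
      finally have "(M *v axis i 1) $ i = (\<Sum>e\<in>B. m e * (e $ i)\<^sup>2)"
        by (simp add: power2_eq_square mult_ac)
      then show ?thesis by (simp add: matrix_vector_mul_component inner_axis)
    qed
    have "trace M = (\<Sum>e\<in>B. \<Sum>i\<in>UNIV. m e * (e $ i)\<^sup>2)"
      unfolding trace_def entry by (rule sum.swap)
    also have "\<dots> = (\<Sum>e\<in>B. m e * (e \<bullet> e))"
      by (simp add: sum_distrib_left inner_vec_def power2_eq_square)
    also have "\<dots> = (\<Sum>e\<in>B. m e)" using B(3) by (intro sum.cong) (auto simp: norm_eq_1)
    finally show ?thesis .
  qed
  have "(A ** A) *v e = (a e)\<^sup>2 *\<^sub>R e" if "e \<in> B" for e
    using a[OF that]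
    by (simp flip: matrix_vector_mul_assoc add: matrix_vector_mult_scaleR power2_eq_square)
  from tr[OF this] tr[OF a] that[OF fin B(1) _ ex a] B(3) show ?thesis by blast
qed

section \<open>Exponential moments of quadratic forms of a sub-Gaussian vector\<close>

lemma std_normal_exp_quadratic:
  fixes p q :: real
  assumes "q < 1"
  shows "(\<integral>\<^sup>+x. ennreal (exp (p * x + q * x\<^sup>2 / 2)) * ennreal (std_normal_density x) \<partial>lborel)
    = ennreal (exp (p\<^sup>2 / (2 * (1 - q))) / sqrt (1 - q))"
proof -
  define m where "m = p / (1 - q)"
  define s where "s = 1 / sqrt (1 - q)"
  define C where "C = exp (p\<^sup>2 / (2 * (1 - q))) / sqrt (1 - q)"
  have q: "1 - q > 0" using assms by simp
  have s: "s > 0" "s\<^sup>2 = 1 / (1 - q)" using q by (auto simp: s_def power_divide)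
  have "exp (p * x + q * x\<^sup>2 / 2) * std_normal_density x = C * normal_density m s x" for x
  proof -
    have "p * x + q * x\<^sup>2 / 2 + - x\<^sup>2 / 2 = p\<^sup>2 / (2 * (1 - q)) + -(x - m)\<^sup>2 / (2 * s\<^sup>2)"
      unfolding m_def s(2) using q by (simp add: power2_eq_square divide_simps) algebra
    then have "exp (p * x + q * x\<^sup>2 / 2) * exp (- x\<^sup>2 / 2) =
        exp (p\<^sup>2 / (2 * (1 - q))) * exp (-(x - m)\<^sup>2 / (2 * s\<^sup>2))"
      by (simp flip: exp_add)
    moreover have "1 / sqrt (2 * pi * s\<^sup>2) = sqrt (1 - q) * (1 / sqrt (2 * pi))"
      using q by (simp add: s(2) real_sqrt_mult real_sqrt_divide)
    ultimately show ?thesis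
      using q by (simp add: std_normal_density_def normal_density_def C_def)
  qed
  then have "(\<integral>\<^sup>+x. ennreal (exp (p * x + q * x\<^sup>2 / 2)) * ennreal (std_normal_density x) \<partial>lborel)
    = (\<integral>\<^sup>+x. ennreal C * ennreal (normal_density m s x) \<partial>lborel)"
    using q by (simp add: ennreal_mult'[symmetric] C_def)
  also have "\<dots> = ennreal C"
    using s by (simp add: nn_integral_cmult nn_integral_eq_integral)
  finally show ?thesis by (simp add: C_def)
qed

text \<open>The sub-Gaussian bound controls exponentials of linear forms only.  Squares are reduced to
  linear forms by \<open>exp (y\<^sup>2 / 2) = \<integral> exp (y * g) d\<gamma>(g)\<close> with \<open>\<gamma>\<close> standard normal: each direction
  \<open>e\<close> contributes an independent Gaussian shift of \<open>v\<close> along \<open>e\<close>, and integrating this shift out of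
  the bound for linear forms is an explicit one-dimensional Gaussian integral.  Orthogonality keeps
  the coordinates of \<open>v\<close> along the other directions unchanged.\<close>

lemma subgaussian_exp_sum_of_squares:
  fixes W :: "'w \<Rightarrow> 'a::euclidean_space"
  assumes "prob_space P" and [measurable]: "W \<in> borel_measurable P"
    and mgf: "\<And>\<alpha>. (\<integral>\<^sup>+\<omega>. ennreal (exp (\<alpha> \<bullet> W \<omega>)) \<partial>P) \<le> ennreal (exp (\<sigma>\<^sup>2 / 2 * (norm \<alpha>)\<^sup>2))"
    and "finite I" and "pairwise orthogonal I" and "\<And>e. e \<in> I \<Longrightarrow> norm e = 1"
    and "\<And>e. e \<in> I \<Longrightarrow> 0 \<le> k e" and "\<And>e. e \<in> I \<Longrightarrow> 2 * \<sigma>\<^sup>2 * k e < 1"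
  shows "(\<integral>\<^sup>+\<omega>. ennreal (exp (v \<bullet> W \<omega> + (\<Sum>e\<in>I. k e * (W \<omega> \<bullet> e)\<^sup>2))) \<partial>P)
    \<le> ennreal (exp (\<sigma>\<^sup>2 / 2 * ((norm v)\<^sup>2 + (\<Sum>e\<in>I. (1 / (1 - 2 * \<sigma>\<^sup>2 * k e) - 1) * (v \<bullet> e)\<^sup>2)))
        * (\<Prod>e\<in>I. 1 / sqrt (1 - 2 * \<sigma>\<^sup>2 * k e)))"
  using assms(4-)
proof (induction I arbitrary: v rule: finite_induct)
  case empty
  show ?case using mgf[of v] by simp
next
  case (insert j I)
  interpret P: prob_space P by fact
  interpret pair_sigma_finite P "lborel :: real measure" ..
  define s where "s = sqrt (2 * k j)"
  define q where "q = 2 * \<sigma>\<^sup>2 * k j"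
  define Q where "Q \<omega> = (\<Sum>e\<in>I. k e * (W \<omega> \<bullet> e)\<^sup>2)" for \<omega>
  define R where "R = (\<Sum>e\<in>I. (1 / (1 - 2 * \<sigma>\<^sup>2 * k e) - 1) * (v \<bullet> e)\<^sup>2)"
  define C where "C = (\<Prod>e\<in>I. 1 / sqrt (1 - 2 * \<sigma>\<^sup>2 * k e))"
  have s2: "s\<^sup>2 = 2 * k j" and q: "q < 1" "q = \<sigma>\<^sup>2 * s\<^sup>2"
    using insert.prems(3,4) by (auto simp: s_def q_def)
  have [measurable]: "Q \<in> borel_measurable P" unfolding Q_def by measurable
  have C: "C \<ge> 0" unfolding C_def
    by (intro prod_nonneg) (use insert.prems(4) in \<open>auto intro: less_imp_le\<close>)
  have jI: "j \<bullet> e = 0" if "e \<in> I" for e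
    using insert.prems(1) insert.hyps(2) that
    by (auto simp: pairwise_insert orthogonal_def)
  have IH: "(\<integral>\<^sup>+\<omega>. ennreal (exp ((v + (s * g) *\<^sub>R j) \<bullet> W \<omega> + Q \<omega>)) \<partial>P)
    \<le> ennreal (exp (\<sigma>\<^sup>2 / 2 * ((norm v)\<^sup>2 + R)) * C * exp ((\<sigma>\<^sup>2 * s * (v \<bullet> j)) * g + q * g\<^sup>2 / 2))"
    for g
  proof -
    have norm_shift:
      "(norm (v + (s * g) *\<^sub>R j))\<^sup>2 = (norm v)\<^sup>2 + 2 * s * g * (v \<bullet> j) + s\<^sup>2 * g\<^sup>2"
      using insert.prems(2)[of j] unfolding power2_norm_eq_inner
      by (simp add: inner_add_left inner_add_right inner_commute
          norm_eq_1 power2_eq_square algebra_simps)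
    have sum_shift:
      "(\<Sum>e\<in>I. (1 / (1 - 2 * \<sigma>\<^sup>2 * k e) - 1) * ((v + (s * g) *\<^sub>R j) \<bullet> e)\<^sup>2) = R"
      unfolding R_def using jI by (intro sum.cong) (simp_all add: inner_add_left)
    have split: "\<sigma>\<^sup>2 / 2 * ((norm v)\<^sup>2 + 2 * s * g * (v \<bullet> j) + s\<^sup>2 * g\<^sup>2 + R) =
        \<sigma>\<^sup>2 / 2 * ((norm v)\<^sup>2 + R) + ((\<sigma>\<^sup>2 * s * (v \<bullet> j)) * g + q * g\<^sup>2 / 2)"
      by (simp add: q(2) algebra_simps)
    have "(\<integral>\<^sup>+\<omega>. ennreal (exp ((v + (s * g) *\<^sub>R j) \<bullet> W \<omega> + Q \<omega>)) \<partial>P) \<le> ennreal (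
        exp (\<sigma>\<^sup>2 / 2 * ((norm (v + (s * g) *\<^sub>R j))\<^sup>2 +
          (\<Sum>e\<in>I. (1 / (1 - 2 * \<sigma>\<^sup>2 * k e) - 1) * ((v + (s * g) *\<^sub>R j) \<bullet> e)\<^sup>2))) * C)"
      unfolding Q_def C_def using insert.prems
      by (intro insert.IH) (auto simp: pairwise_insert)
    also have "\<dots> = ennreal (exp (\<sigma>\<^sup>2 / 2 * ((norm v)\<^sup>2 + R)) * C *
        exp ((\<sigma>\<^sup>2 * s * (v \<bullet> j)) * g + q * g\<^sup>2 / 2))"
      unfolding norm_shift sum_shift split mult_exp_exp[symmetric] by (simp only: mult_ac)
    finally show ?thesis .
  qed
  have "(\<integral>\<^sup>+\<omega>. ennreal (exp (v \<bullet> W \<omega> + (\<Sum>e\<in>insert j I. k e * (W \<omega> \<bullet> e)\<^sup>2))) \<partial>P)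
    = (\<integral>\<^sup>+\<omega>. ennreal (exp (v \<bullet> W \<omega> + Q \<omega>)) * ennreal (exp ((s * (W \<omega> \<bullet> j))\<^sup>2 / 2)) \<partial>P)"
    using insert.hyps s2
    by (simp add: Q_def ennreal_mult'[symmetric] exp_add[symmetric] power_mult_distrib algebra_simps)
  also have "\<dots> = (\<integral>\<^sup>+\<omega>. (\<integral>\<^sup>+g. ennreal (exp ((v + (s * g) *\<^sub>R j) \<bullet> W \<omega> + Q \<omega>)) *
      ennreal (std_normal_density g) \<partial>lborel) \<partial>P)"
  proof (intro nn_integral_cong)
    fix \<omega>
    have "ennreal (exp (v \<bullet> W \<omega> + Q \<omega>)) * ennreal (exp ((s * (W \<omega> \<bullet> j))\<^sup>2 / 2))
      = (\<integral>\<^sup>+g. ennreal (exp (v \<bullet> W \<omega> + Q \<omega>)) * (ennreal (exp (s * (W \<omega> \<bullet> j) * g + 0 * g\<^sup>2 / 2)) *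
      ennreal (std_normal_density g)) \<partial>lborel)"
      by (subst nn_integral_cmult, measurable) (subst std_normal_exp_quadratic, simp_all)
    also have "\<dots> = (\<integral>\<^sup>+g. ennreal (exp ((v + (s * g) *\<^sub>R j) \<bullet> W \<omega> + Q \<omega>)) *
      ennreal (std_normal_density g) \<partial>lborel)"
    proof (intro nn_integral_cong)
      fix g
      have "exp (v \<bullet> W \<omega> + Q \<omega>) * exp (s * (W \<omega> \<bullet> j) * g + 0 * g\<^sup>2 / 2) =
          exp ((v + (s * g) *\<^sub>R j) \<bullet> W \<omega> + Q \<omega>)"
        by (simp add: mult_exp_exp inner_add_left inner_commute[of j] mult_ac)
      then show "ennreal (exp (v \<bullet> W \<omega> + Q \<omega>)) * (ennreal (exp (s * (W \<omega> \<bullet> j) * g + 0 * g\<^sup>2 / 2)) *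
          ennreal (std_normal_density g)) = ennreal (exp ((v + (s * g) *\<^sub>R j) \<bullet> W \<omega> + Q \<omega>)) *
          ennreal (std_normal_density g)"
        by (simp only: mult.assoc[symmetric] ennreal_mult'[OF exp_ge_zero, symmetric])
    qed
    finally show "ennreal (exp (v \<bullet> W \<omega> + Q \<omega>)) * ennreal (exp ((s * (W \<omega> \<bullet> j))\<^sup>2 / 2)) = \<dots>" .
  qed
  also have "\<dots> = (\<integral>\<^sup>+g. (\<integral>\<^sup>+\<omega>. ennreal (exp ((v + (s * g) *\<^sub>R j) \<bullet> W \<omega> + Q \<omega>)) *
      ennreal (std_normal_density g) \<partial>P) \<partial>lborel)"
    by (rule Fubini'[symmetric]) measurable
  also have "\<dots> = (\<integral>\<^sup>+g. (\<integral>\<^sup>+\<omega>. ennreal (exp ((v + (s * g) *\<^sub>R j) \<bullet> W \<omega> + Q \<omega>)) \<partial>P) *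
      ennreal (std_normal_density g) \<partial>lborel)"
    by (intro nn_integral_cong nn_integral_multc) measurable
  also have "\<dots> \<le> (\<integral>\<^sup>+g. ennreal (exp (\<sigma>\<^sup>2 / 2 * ((norm v)\<^sup>2 + R)) * C *
      exp ((\<sigma>\<^sup>2 * s * (v \<bullet> j)) * g + q * g\<^sup>2 / 2)) * ennreal (std_normal_density g) \<partial>lborel)"
    by (intro nn_integral_mono mult_right_mono IH) auto
  also have "\<dots> = (\<integral>\<^sup>+g. ennreal (exp (\<sigma>\<^sup>2 / 2 * ((norm v)\<^sup>2 + R)) * C) *
      (ennreal (exp ((\<sigma>\<^sup>2 * s * (v \<bullet> j)) * g + q * g\<^sup>2 / 2)) * ennreal (std_normal_density g)) \<partial>lborel)"
    using C by (simp add: ennreal_mult mult_ac)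
  also have "\<dots> = ennreal (exp (\<sigma>\<^sup>2 / 2 * ((norm v)\<^sup>2 + R)) * C) *
      ennreal (exp ((\<sigma>\<^sup>2 * s * (v \<bullet> j))\<^sup>2 / (2 * (1 - q))) / sqrt (1 - q))"
    by (subst nn_integral_cmult) (measurable, simp only: std_normal_exp_quadratic[OF q(1)])
  also have "\<dots> = ennreal (exp (\<sigma>\<^sup>2 / 2 * ((norm v)\<^sup>2 + R) + (\<sigma>\<^sup>2 * s * (v \<bullet> j))\<^sup>2 / (2 * (1 - q)))
      * (1 / sqrt (1 - q) * C))"
    using C q by (simp add: ennreal_mult[symmetric] exp_add)
  also have "(\<sigma>\<^sup>2 * s * (v \<bullet> j))\<^sup>2 / (2 * (1 - q)) = \<sigma>\<^sup>2 / 2 * ((1 / (1 - q) - 1) * (v \<bullet> j)\<^sup>2)"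
  proof -
    have "(\<sigma>\<^sup>2 * s * (v \<bullet> j))\<^sup>2 = \<sigma>\<^sup>2 * q * (v \<bullet> j)\<^sup>2"
      by (simp add: q(2) power_mult_distrib)
    then show ?thesis using q(1) by (simp add: field_simps)
  qed
  finally show ?case
    using insert.hyps by (simp add: R_def C_def q_def algebra_simps)
qed

lemma ln_le_half_diff_inverse:
  fixes z :: real
  assumes "z \<ge> 1"
  shows "ln z \<le> (z - 1 / z) / 2"
proof -
  have "(1 - 1 / 1) / 2 - ln 1 \<le> (z - 1 / z) / 2 - ln z"
  proof (rule DERIV_nonneg_imp_nondecreasing[OF assms])
    fix x :: real assume x: "1 \<le> x"
    have "((\<lambda>z. (z - 1 / z) / 2 - ln z) has_real_derivative (1 - 1 / x)\<^sup>2 / 2) (at x)"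
      using x by (auto intro!: derivative_eq_intros simp: power2_eq_square field_simps)
    then show "\<exists>y. ((\<lambda>z. (z - 1 / z) / 2 - ln z) has_real_derivative y) (at x) \<and> 0 \<le> y"
      by auto
  qed
  then show ?thesis by simp
qed

lemma inverse_sqrt_one_minus_le_exp:
  fixes y :: real
  assumes "0 \<le> y" "y \<le> x" "x < 1"
  shows "1 / sqrt (1 - y) \<le> exp (y / 2 + y\<^sup>2 / (4 * (1 - x)))"
proof -
  define T where "T = y\<^sup>2 / (4 * (1 - x))"
  have y: "1 - y > 0" using assms by simp
  have "ln (1 / (1 - y)) \<le> (1 / (1 - y) - (1 - y)) / 2"
    using ln_le_half_diff_inverse[of "1 / (1 - y)"] assms y by simp
  also have "\<dots> = y + y\<^sup>2 / (2 * (1 - y))"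
    using y by (simp add: divide_simps) (simp add: power2_eq_square algebra_simps)
  also have "\<dots> \<le> y + y\<^sup>2 / (2 * (1 - x))"
    using assms by (intro add_left_mono divide_left_mono) auto
  also have "y\<^sup>2 / (2 * (1 - x)) = 2 * T"
    using assms by (simp add: T_def divide_simps)
  finally have "ln (1 / (1 - y)) / 2 \<le> y / 2 + T"
    by simp
  moreover have "1 / sqrt (1 - y) = exp (ln (1 / (1 - y)) / 2)"
    using y by (simp add: ln_div ln_sqrt[symmetric] exp_minus inverse_eq_divide)
  ultimately show ?thesis by (simp add: T_def)
qed

text \<open>The quadratic form is a sum of squares in an eigenbasis.  The determinant factor
  \<open>\<Prod>(1 - x\<^sub>e) powr (-1/2)\<close> is expanded to second order in the eigenvalues, which
  produces the two traces.\<close>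

lemma subgaussian_exp_quadratic_form:
  fixes W :: "'w \<Rightarrow> real^'n" and A :: "real^'n^'n"
  assumes "prob_space P" and W: "centred_subgaussian P W \<sigma>"
    and A: "psd_matrix A" "onorm ((*v) A) \<le> 1"
    and l: "0 \<le> l" "2 * l * \<sigma>\<^sup>2 < 1"
  shows "(\<integral>\<^sup>+\<omega>. ennreal (exp (v \<bullet> W \<omega> + l * (W \<omega> \<bullet> (A *v W \<omega>)))) \<partial>P)
    \<le> ennreal (exp (\<sigma>\<^sup>2 * (norm v)\<^sup>2 / (2 * (1 - 2 * l * \<sigma>\<^sup>2)) + l * \<sigma>\<^sup>2 * trace A
          + l\<^sup>2 * \<sigma>^4 * trace (A ** A) / (1 - 2 * l * \<sigma>\<^sup>2)))"
proof -
  obtain B a where B: "finite B" "pairwise orthogonal B" "\<And>e. e \<in> B \<Longrightarrow> norm e = 1"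
    and ex: "\<And>z. (\<Sum>e\<in>B. (z \<bullet> e) *\<^sub>R e) = z"
    and a: "\<And>e. e \<in> B \<Longrightarrow> A *v e = a e *\<^sub>R e"
    and tr: "trace A = sum a B" "trace (A ** A) = (\<Sum>e\<in>B. (a e)\<^sup>2)"
    by (rule symmetric_matrix_eigenbasis[of A]) (use A(1) in \<open>auto simp: psd_matrix_def\<close>)
  define x where "x = 2 * l * \<sigma>\<^sup>2"
  define y where "y e = 2 * \<sigma>\<^sup>2 * (l * a e)" for e
  have a01: "0 \<le> a e" "a e \<le> 1" if e: "e \<in> B" for e
  proof -
    have "0 \<le> e \<bullet> (A *v e)" using A(1) by (simp add: psd_matrix_def)
    then show "0 \<le> a e" using a[OF e] B(3)[OF e] by (simp add: norm_eq_1)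
    have "norm (A *v e) \<le> onorm ((*v) A) * norm e"
      by (intro onorm matrix_vector_mul_bounded_linear)
    then show "a e \<le> 1" using a[OF e] B(3)[OF e] A(2) by simp
  qed
  have y: "0 \<le> y e" "y e \<le> x" if "e \<in> B" for e
  proof -
    show "0 \<le> y e" using a01[OF that] l by (simp add: y_def)
    have "2 * \<sigma>\<^sup>2 * l * a e \<le> 2 * \<sigma>\<^sup>2 * l * 1"
      using a01[OF that] l by (intro mult_left_mono) auto
    then show "y e \<le> x" by (simp add: y_def x_def mult_ac)
  qed
  have x: "x < 1" using l by (simp add: x_def)
  have pos: "0 < 1 - y e" "1 - x \<le> 1 - y e" if "e \<in> B" for e
    using y(2)[OF that] x by auto
  have parseval: "(\<Sum>e\<in>B. (z \<bullet> e)\<^sup>2) = (norm z)\<^sup>2" for z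
  proof -
    have "(norm z)\<^sup>2 = z \<bullet> (\<Sum>e\<in>B. (z \<bullet> e) *\<^sub>R e)" by (simp add: ex power2_norm_eq_inner)
    then show ?thesis by (simp add: inner_sum_right power2_eq_square)
  qed
  have form: "w \<bullet> (A *v w) = (\<Sum>e\<in>B. a e * (w \<bullet> e)\<^sup>2)" for w
  proof -
    have "w \<bullet> (A *v w) = w \<bullet> (A *v (\<Sum>e\<in>B. (w \<bullet> e) *\<^sub>R e))" by (simp add: ex)
    also have "\<dots> = (\<Sum>e\<in>B. a e * (w \<bullet> e)\<^sup>2)"
      by (simp add: linear_sum[OF matrix_vector_mul_linear] matrix_vector_mult_scaleR a
          inner_sum_right power2_eq_square mult_ac cong: sum.cong)
    finally show ?thesis .
  qed
  have "(\<integral>\<^sup>+\<omega>. ennreal (exp (v \<bullet> W \<omega> + l * (W \<omega> \<bullet> (A *v W \<omega>)))) \<partial>P) =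
    (\<integral>\<^sup>+\<omega>. ennreal (exp (v \<bullet> W \<omega> + (\<Sum>e\<in>B. (l * a e) * (W \<omega> \<bullet> e)\<^sup>2))) \<partial>P)"
    by (simp add: form sum_distrib_left mult.assoc)
  also have "\<dots> \<le> ennreal (exp (\<sigma>\<^sup>2 / 2 * ((norm v)\<^sup>2 +
        (\<Sum>e\<in>B. (1 / (1 - y e) - 1) * (v \<bullet> e)\<^sup>2))) * (\<Prod>e\<in>B. 1 / sqrt (1 - y e)))"
    unfolding y_def
  proof (rule subgaussian_exp_sum_of_squares)
    show "2 * \<sigma>\<^sup>2 * (l * a e) < 1" if "e \<in> B" for e
      using y(2)[OF that] x by (simp add: y_def)
  qed (use assms B a01 in \<open>auto simp: centred_subgaussian_def\<close>)
  also have "\<dots> \<le> ennreal (exp (\<sigma>\<^sup>2 * (norm v)\<^sup>2 / (2 * (1 - x))) *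
      exp (\<Sum>e\<in>B. y e / 2 + (y e)\<^sup>2 / (4 * (1 - x))))"
  proof (intro ennreal_leI mult_mono)
    have "(\<Sum>e\<in>B. (1 / (1 - y e) - 1) * (v \<bullet> e)\<^sup>2) \<le> (\<Sum>e\<in>B. (1 / (1 - x) - 1) * (v \<bullet> e)\<^sup>2)"
      using pos x by (intro sum_mono mult_right_mono diff_right_mono divide_left_mono) simp_all
    also have "\<dots> = (1 / (1 - x) - 1) * (norm v)\<^sup>2"
      by (simp add: sum_distrib_left[symmetric] parseval)
    finally have "(norm v)\<^sup>2 + (\<Sum>e\<in>B. (1 / (1 - y e) - 1) * (v \<bullet> e)\<^sup>2) \<le> (norm v)\<^sup>2 / (1 - x)"
      by (simp add: algebra_simps)
    then have "\<sigma>\<^sup>2 / 2 * ((norm v)\<^sup>2 + (\<Sum>e\<in>B. (1 / (1 - y e) - 1) * (v \<bullet> e)\<^sup>2))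
        \<le> \<sigma>\<^sup>2 / 2 * ((norm v)\<^sup>2 / (1 - x))"
      by (intro mult_left_mono) auto
    then show "exp (\<sigma>\<^sup>2 / 2 * ((norm v)\<^sup>2 + (\<Sum>e\<in>B. (1 / (1 - y e) - 1) * (v \<bullet> e)\<^sup>2)))
        \<le> exp (\<sigma>\<^sup>2 * (norm v)\<^sup>2 / (2 * (1 - x)))" by simp
    show "(\<Prod>e\<in>B. 1 / sqrt (1 - y e)) \<le> exp (\<Sum>e\<in>B. y e / 2 + (y e)\<^sup>2 / (4 * (1 - x)))"
      unfolding exp_sum[OF B(1)]
      using y x pos
      by (intro prod_mono conjI inverse_sqrt_one_minus_le_exp) (simp_all add: less_imp_le)
    show "0 \<le> (\<Prod>e\<in>B. 1 / sqrt (1 - y e))"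
      using pos by (intro prod_nonneg) (simp add: less_imp_le)
  qed simp
  also have "(\<Sum>e\<in>B. y e / 2 + (y e)\<^sup>2 / (4 * (1 - x))) =
      l * \<sigma>\<^sup>2 * trace A + l\<^sup>2 * \<sigma>^4 * trace (A ** A) / (1 - x)"
  proof -
    have "(\<Sum>e\<in>B. y e / 2) = l * \<sigma>\<^sup>2 * trace A"
      unfolding tr sum_distrib_left by (intro sum.cong refl) (simp add: y_def)
    moreover have "(\<Sum>e\<in>B. (y e)\<^sup>2 / (4 * (1 - x))) = l\<^sup>2 * \<sigma>^4 * trace (A ** A) / (1 - x)"
      unfolding tr sum_distrib_left sum_divide_distrib
      by (intro sum.cong refl) (use x in \<open>simp add: y_def power_mult_distrib divide_simps flip: power_mult\<close>)
    ultimately show ?thesis by (simp add: sum.distrib)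
  qed
  finally show ?thesis unfolding x_def mult_exp_exp add.assoc .
qed

section \<open>The Gibbs variational principle\<close>

lemma integrable_exp_uminus:
  fixes \<phi> :: "'t \<Rightarrow> real"
  assumes "prob_space \<pi>" and [measurable]: "\<phi> \<in> borel_measurable \<pi>"
    and "\<And>t. t \<in> space \<pi> \<Longrightarrow> c \<le> \<phi> t"
  shows "integrable \<pi> (\<lambda>t. exp (- \<phi> t))"
proof -
  interpret prob_space \<pi> by fact
  show ?thesis
    by (rule integrable_const_bound[where B="exp (- c)"]) (auto intro: AE_I2 assms(3))
qed

lemma integral_exp_pos:
  fixes \<phi> :: "'t \<Rightarrow> real"
  assumes "prob_space \<pi>" and "integrable \<pi> (\<lambda>t. exp (\<phi> t))"
  shows "0 < (\<integral>t. exp (\<phi> t) \<partial>\<pi>)"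
proof -
  interpret prob_space \<pi> by fact
  have "(\<integral>t. exp (\<phi> t) \<partial>\<pi>) \<noteq> 0"
  proof
    assume "(\<integral>t. exp (\<phi> t) \<partial>\<pi>) = 0"
    then have "AE t in \<pi>. exp (\<phi> t) = 0"
      using assms(2) by (subst (asm) integral_nonneg_eq_0_iff_AE) auto
    then show False by (simp add: AE_False)
  qed
  then show ?thesis
    by (metis Bochner_Integration.integral_nonneg exp_ge_zero order_less_le)
qed

text \<open>With \<open>D\<close> the density of \<open>\<mu>\<close>, the tangent bound \<open>ln x \<le> x - 1\<close> at
  \<open>x = exp (- \<phi>) / (D * V)\<close> integrates to the claim, because the \<open>\<mu>\<close>-integral of
  \<open>exp (- \<phi>) / D\<close> is at most the \<open>\<pi>\<close>-integral \<open>V\<close> of \<open>exp (- \<phi>)\<close>.\<close>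

lemma gibbs_variational_inequality:
  fixes \<phi> :: "'t \<Rightarrow> real"
  assumes "prob_space \<pi>" and [measurable]: "\<phi> \<in> borel_measurable \<pi>"
    and nn: "\<And>t. t \<in> space \<pi> \<Longrightarrow> 0 \<le> \<phi> t"
    and "prob_space \<mu>" and sets: "sets \<mu> = sets \<pi>"
  shows "ennreal (- ln (\<integral>t. exp (- \<phi> t) \<partial>\<pi>)) \<le> (\<integral>\<^sup>+t. ennreal (\<phi> t) \<partial>\<mu>) + KL \<mu> \<pi>"
proof (cases "(\<integral>\<^sup>+t. ennreal (\<phi> t) \<partial>\<mu>) = \<infinity> \<or> KL \<mu> \<pi> = \<infinity>")
  case True
  then show ?thesis by auto
next
  case False
  interpret pi: prob_space \<pi> by fact
  interpret mu: prob_space \<mu> by fact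
  note [measurable_cong] = sets
  have sp: "space \<mu> = space \<pi>" using sets by (rule sets_eq_imp_space_eq)
  define V where "V = (\<integral>t. exp (- \<phi> t) \<partial>\<pi>)"
  have iV: "integrable \<pi> (\<lambda>t. exp (- \<phi> t))"
    using assms(1-3) by (rule integrable_exp_uminus)
  have V: "V > 0"
    unfolding V_def using assms(1) iV by (rule integral_exp_pos)
  define L where "L = entropy_density (exp 1) \<pi> \<mu>"
  have ac: "absolutely_continuous \<pi> \<mu>" and iL: "integrable \<mu> L"
    and KL: "KL \<mu> \<pi> = ennreal (\<integral>t. L t \<partial>\<mu>)"
    using False by (auto simp: KL_def KL_divergence_def L_def split: if_splits)
  obtain D where D: "D \<in> borel_measurable \<pi>"
    "AE t in \<pi>. RN_deriv \<pi> \<mu> t = ennreal (D t)" "AE t in \<mu>. 0 < D t" "\<And>t. 0 \<le> D t"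
    using pi.real_RN_deriv[OF mu.finite_measure_axioms ac sets] by metis
  note [measurable] = D(1)
  have \<mu>: "\<mu> = density \<pi> (\<lambda>t. ennreal (D t))"
  proof -
    have "\<mu> = density \<pi> (RN_deriv \<pi> \<mu>)"
      using ac sets by (simp add: pi.density_RN_deriv)
    also have "\<dots> = density \<pi> (\<lambda>t. ennreal (D t))"
      using D by (intro density_cong) auto
    finally show ?thesis .
  qed
  have L_eq: "AE t in \<mu>. L t = ln (D t)"
    using absolutely_continuous_AE[OF sets ac D(2)]
    by eventually_elim (simp add: L_def entropy_density_def D(4) log_def)
  have i\<phi>: "integrable \<mu> \<phi>"
  proof (rule integrableI_nonneg)
    show "AE t in \<mu>. 0 \<le> \<phi> t" by (auto intro!: AE_I2 nn simp: sp)
    show "(\<integral>\<^sup>+t. ennreal (\<phi> t) \<partial>\<mu>) < \<infinity>" using False by (auto simp: top.not_eq_extremum)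
  qed measurable
  define h where "h t = exp (- \<phi> t) / D t" for t
  have [measurable]: "h \<in> borel_measurable \<pi>" unfolding h_def by measurable
  have h_nn: "0 \<le> h t" for t using D(4) by (simp add: h_def)
  have h_le: "(\<integral>\<^sup>+t. ennreal (h t) \<partial>\<mu>) \<le> ennreal V"
  proof -
    have "(\<integral>\<^sup>+t. ennreal (h t) \<partial>\<mu>) = (\<integral>\<^sup>+t. ennreal (D t) * ennreal (h t) \<partial>\<pi>)"
      by (subst (1) \<mu>, subst nn_integral_density) auto
    also have "\<dots> \<le> (\<integral>\<^sup>+t. ennreal (exp (- \<phi> t)) \<partial>\<pi>)"
      using D(4) by (intro nn_integral_mono) (auto simp: h_def ennreal_mult'[symmetric])
    also have "\<dots> = ennreal V"
      unfolding V_def using iV by (intro nn_integral_eq_integral) auto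
    finally show ?thesis .
  qed
  have ih: "integrable \<mu> h"
    using h_le h_nn by (intro integrableI_nonneg) (auto intro: le_less_trans)
  have "ennreal (\<integral>t. h t \<partial>\<mu>) \<le> ennreal V"
    using h_le ih h_nn by (subst nn_integral_eq_integral[symmetric]) auto
  then have h_int: "(\<integral>t. h t \<partial>\<mu>) \<le> V" using V by simp
  have "(\<integral>t. - \<phi> t - L t - ln V \<partial>\<mu>) \<le> (\<integral>t. h t / V - 1 \<partial>\<mu>)"
  proof (rule integral_mono_AE)
    show "AE t in \<mu>. - \<phi> t - L t - ln V \<le> h t / V - 1"
      using L_eq D(3)
    proof eventually_elim
      case (elim t)
      have "- \<phi> t - L t - ln V = ln (h t / V)"
        using elim V by (simp add: h_def ln_div ln_mult)
      also have "\<dots> \<le> h t / V - 1"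
        using elim V by (intro ln_le_minus_one) (simp add: h_def)
      finally show ?case .
    qed
  qed (use i\<phi> iL ih in auto)
  also have "\<dots> \<le> 0"
    using h_int ih V by (simp add: mu.prob_space)
  finally have main: "- ln V \<le> (\<integral>t. \<phi> t \<partial>\<mu>) + (\<integral>t. L t \<partial>\<mu>)"
    using i\<phi> iL by (simp add: mu.prob_space)
  have "ennreal (- ln V) \<le> ennreal (\<integral>t. \<phi> t \<partial>\<mu>) + ennreal (\<integral>t. L t \<partial>\<mu>)"
  proof (cases "0 \<le> (\<integral>t. L t \<partial>\<mu>)")
    case True
    moreover have "0 \<le> (\<integral>t. \<phi> t \<partial>\<mu>)"
      using nn by (intro Bochner_Integration.integral_nonneg) (simp add: sp)
    ultimately show ?thesis
      using main by (simp add: ennreal_plus[symmetric] ennreal_leI del: ennreal_plus)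
  next
    case False
    then have "ennreal (- ln V) \<le> ennreal (\<integral>t. \<phi> t \<partial>\<mu>)" using main by (intro ennreal_leI) simp
    then show ?thesis by (simp add: add_increasing2)
  qed
  also have "ennreal (\<integral>t. \<phi> t \<partial>\<mu>) = (\<integral>\<^sup>+t. ennreal (\<phi> t) \<partial>\<mu>)"
    using i\<phi> nn by (intro nn_integral_eq_integral[symmetric] AE_I2) (auto simp: sp)
  finally show ?thesis by (simp add: KL V_def)
qed

text \<open>Equality holds at the Gibbs measure.  Its divergence from \<open>\<pi>\<close> is finite since
  \<open>\<phi> * exp (- \<phi>) \<le> 1\<close>, even if \<open>\<phi>\<close> is not \<open>\<pi>\<close>-integrable.\<close>

lemma gibbs_variational_attained:
  fixes \<phi> :: "'t \<Rightarrow> real"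
  assumes "prob_space \<pi>" and [measurable]: "\<phi> \<in> borel_measurable \<pi>"
    and nn: "\<And>t. t \<in> space \<pi> \<Longrightarrow> 0 \<le> \<phi> t"
  obtains \<mu> where "prob_space \<mu>" "sets \<mu> = sets \<pi>"
    "(\<integral>\<^sup>+t. ennreal (\<phi> t) \<partial>\<mu>) + KL \<mu> \<pi> = ennreal (- ln (\<integral>t. exp (- \<phi> t) \<partial>\<pi>))"
proof -
  interpret pi: information_space \<pi> "exp 1"
    using assms(1) by (simp add: information_space_def information_space_axioms_def)
  define V where "V = (\<integral>t. exp (- \<phi> t) \<partial>\<pi>)"
  have iV: "integrable \<pi> (\<lambda>t. exp (- \<phi> t))"
    using assms(1-3) by (rule integrable_exp_uminus)
  have V: "V > 0"
    unfolding V_def using assms(1) iV by (rule integral_exp_pos)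
  define f where "f t = exp (- \<phi> t) / V" for t
  have [measurable]: "f \<in> borel_measurable \<pi>" unfolding f_def by measurable
  have f: "0 < f t" "ln (f t) = - \<phi> t - ln V" for t
    using V by (auto simp: f_def ln_div)
  have f0: "0 \<le> f t" for t using f(1)[of t] by simp
  define \<mu> where "\<mu> = density \<pi> (\<lambda>t. ennreal (f t))"
  have if1: "integrable \<pi> f" "(\<integral>t. f t \<partial>\<pi>) = 1"
    unfolding f_def[abs_def] using iV V by (auto simp: V_def)
  have p\<mu>: "prob_space \<mu>"
    unfolding \<mu>_def using if1 f0
    by (intro prob_spaceI) (simp add: emeasure_density nn_integral_eq_integral cong: nn_integral_cong)
  have if\<phi>: "integrable \<pi> (\<lambda>t. f t * \<phi> t)"
  proof (rule pi.integrable_const_bound[where B="1 / V"])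
    have "f t * \<phi> t \<le> 1 / V" for t
    proof -
      have "\<phi> t \<le> exp (\<phi> t)" using exp_ge_add_one_self[of "\<phi> t"] by linarith
      then have "exp (- \<phi> t) * \<phi> t \<le> exp (- \<phi> t) * exp (\<phi> t)"
        by (intro mult_left_mono) auto
      then show ?thesis using V by (simp add: f_def mult_exp_exp divide_right_mono)
    qed
    then show "AE t in \<pi>. norm (f t * \<phi> t) \<le> 1 / V"
      using nn f0 by (intro AE_I2) simp
  qed measurable
  have ifl: "integrable \<pi> (\<lambda>t. f t * ln (f t))"
    using if\<phi> if1(1) by (simp add: f(2) right_diff_distrib)
  have "density \<pi> (RN_deriv \<pi> \<mu>) = \<mu>"
    unfolding \<mu>_def using f0 by (intro density_RN_deriv_density) auto
  then have "AE t in \<pi>. RN_deriv \<pi> \<mu> t = f t"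
    unfolding \<mu>_def using f0 by (intro pi.density_unique) auto
  then have L: "AE t in \<pi>. entropy_density (exp 1) \<pi> \<mu> t = ln (f t)"
    by eventually_elim (simp add: entropy_density_def f0 log_def)
  have ent: "integrable \<mu> (entropy_density (exp 1) \<pi> \<mu>)"
  proof -
    have "integrable \<pi> (\<lambda>t. f t *\<^sub>R entropy_density (exp 1) \<pi> \<mu> t) \<longleftrightarrow>
        integrable \<pi> (\<lambda>t. f t * ln (f t))"
      using L by (intro integrable_cong_AE) auto
    then show ?thesis
      using ifl f0 by (subst (1) \<mu>_def) (subst integrable_density, auto)
  qed
  have ac: "absolutely_continuous \<pi> \<mu>"
    unfolding \<mu>_def by (intro absolutely_continuousI_density) measurable
  have KL: "KL \<mu> \<pi> = ennreal (KL_divergence (exp 1) \<pi> \<mu>)"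
    using ac ent by (simp add: KL_def)
  have "KL_divergence (exp 1) \<pi> \<mu> = (\<integral>t. f t * ln (f t) \<partial>\<pi>)"
    unfolding \<mu>_def using f0 by (subst pi.KL_density) (auto simp: log_def)
  also have "\<dots> = (\<integral>t. - (f t * \<phi> t) - ln V * f t \<partial>\<pi>)"
    by (intro Bochner_Integration.integral_cong) (simp_all add: f(2) algebra_simps)
  also have "\<dots> = - (\<integral>t. f t * \<phi> t \<partial>\<pi>) - ln V"
    using if\<phi> if1 by simp
  finally have kl: "KL_divergence (exp 1) \<pi> \<mu> = - (\<integral>t. f t * \<phi> t \<partial>\<pi>) - ln V" .
  have kl0: "0 \<le> KL_divergence (exp 1) \<pi> \<mu>"
    unfolding \<mu>_def using p\<mu> f0 ifl
    by (intro pi.KL_nonneg) (auto simp: \<mu>_def log_def)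
  have "(\<integral>\<^sup>+t. ennreal (\<phi> t) \<partial>\<mu>) = (\<integral>\<^sup>+t. ennreal (f t * \<phi> t) \<partial>\<pi>)"
    unfolding \<mu>_def using f0 by (subst nn_integral_density) (auto simp: ennreal_mult')
  also have "\<dots> = ennreal (\<integral>t. f t * \<phi> t \<partial>\<pi>)"
    using if\<phi> nn f0 by (intro nn_integral_eq_integral AE_I2) auto
  finally have "(\<integral>\<^sup>+t. ennreal (\<phi> t) \<partial>\<mu>) + KL \<mu> \<pi> = ennreal (- ln V)"
    using kl kl0 KL nn f0
    by (subst (asm) kl) (auto simp: ennreal_plus[symmetric] kl
        intro!: Bochner_Integration.integral_nonneg simp del: ennreal_plus)
  with that[OF p\<mu>] show ?thesis by (simp add: \<mu>_def V_def)
qed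

section \<open>Exponential weights\<close>

text \<open>Weights that decay at least like \<open>exp (- (norm u ^ 2) / \<beta>)\<close> beat the linear growth of
  \<open>u\<close>.  The exponential weights are of this kind because the penalised risk dominates the squared
  residual up to a constant; hence the aggregate is a genuine mean and not the default value of a divergent
  integral.\<close>

lemma integrable_gibbs_density:
  fixes u :: "'t \<Rightarrow> 'a::euclidean_space" and R :: "'t \<Rightarrow> real"
  assumes "prob_space \<pi>" and [measurable]: "u \<in> borel_measurable \<pi>" "R \<in> borel_measurable \<pi>"
    and "\<beta> > 0" and "Z > 0"
    and R: "\<And>t. t \<in> space \<pi> \<Longrightarrow> (norm (u t))\<^sup>2 / \<beta> - c \<le> R t"
  shows "integrable (density \<pi> (\<lambda>t. ennreal (exp (- R t) / Z))) u"
proof -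
  interpret prob_space \<pi> by fact
  have "norm (exp (- R t) / Z) * norm (u t) \<le> (1 + \<beta>) * exp c / Z" if "t \<in> space \<pi>" for t
  proof -
    define x where "x = norm (u t)"
    have "x \<le> (1 + \<beta>) * (1 + x\<^sup>2 / \<beta>)"
    proof -
      have "0 \<le> (x - 1)\<^sup>2" by simp
      then have "2 * x \<le> 1 + x\<^sup>2" by (simp add: power2_diff)
      then have "x \<le> 1 + x\<^sup>2" using zero_le_power2[of x] by linarith
      also have "\<dots> \<le> 1 + \<beta> + x\<^sup>2 / \<beta> + x\<^sup>2" using \<open>\<beta> > 0\<close> by simp
      also have "\<dots> = (1 + \<beta>) * (1 + x\<^sup>2 / \<beta>)" using \<open>\<beta> > 0\<close> by (simp add: field_simps)
      finally show ?thesis .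
    qed
    also have "\<dots> \<le> (1 + \<beta>) * exp (x\<^sup>2 / \<beta>)"
      using \<open>\<beta> > 0\<close> exp_ge_add_one_self[of "x\<^sup>2 / \<beta>"] by (intro mult_left_mono) auto
    finally have "exp (- R t) * x \<le> exp (- R t) * ((1 + \<beta>) * exp (x\<^sup>2 / \<beta>))"
      by (intro mult_left_mono) auto
    also have "\<dots> = (1 + \<beta>) * exp (x\<^sup>2 / \<beta> - R t)" by (simp add: exp_diff exp_minus field_simps)
    also have "\<dots> \<le> (1 + \<beta>) * exp c"
      using R[OF that] \<open>\<beta> > 0\<close> by (intro mult_left_mono) (auto simp: x_def)
    finally show ?thesis using \<open>Z > 0\<close> by (simp add: x_def field_simps)
  qed
  then have "integrable \<pi> (\<lambda>t. (exp (- R t) / Z) *\<^sub>R u t)"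
    by (intro integrable_const_bound[where B="(1 + \<beta>) * exp c / Z"] AE_I2) simp_all
  then show ?thesis using \<open>Z > 0\<close> by (subst integrable_density) auto
qed

lemma prob_space_gibbs_density:
  fixes R :: "'t \<Rightarrow> real"
  assumes "prob_space \<pi>" and "integrable \<pi> (\<lambda>t. exp (- R t))"
  shows "prob_space (density \<pi> (\<lambda>t. ennreal (exp (- R t) / (\<integral>t. exp (- R t) \<partial>\<pi>))))"
proof -
  define Z where "Z = (\<integral>t. exp (- R t) \<partial>\<pi>)"
  have "Z > 0" unfolding Z_def using assms by (rule integral_exp_pos)
  moreover have "(\<integral>\<^sup>+t. ennreal (exp (- R t) / Z) \<partial>\<pi>) = ennreal (\<integral>t. exp (- R t) / Z \<partial>\<pi>)"
    using assms(2) \<open>Z > 0\<close> by (intro nn_integral_eq_integral) auto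
  moreover have "(\<lambda>t. exp (- R t) / Z) \<in> borel_measurable \<pi>"
    using assms(2) by (intro borel_measurable_divide borel_measurable_integrable) auto
  ultimately show ?thesis
    unfolding Z_def[symmetric]
    by (intro prob_spaceI) (simp add: emeasure_density Z_def[symmetric] cong: nn_integral_cong)
qed

text \<open>Jensen's inequality for the convex function \<open>exp (norm x ^ 2 / \<beta>)\<close>, through its tangent
  plane at the mean \<open>m\<close>.\<close>

lemma exp_norm_mean_le:
  fixes v :: "'t \<Rightarrow> 'a::euclidean_space"
  assumes "prob_space \<rho>" and iv: "integrable \<rho> v" and "\<beta> > 0"
  shows "ennreal (exp ((norm (\<integral>t. v t \<partial>\<rho>))\<^sup>2 / \<beta>)) \<le> (\<integral>\<^sup>+t. ennreal (exp ((norm (v t))\<^sup>2 / \<beta>)) \<partial>\<rho>)"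
proof (cases "integrable \<rho> (\<lambda>t. exp ((norm (v t))\<^sup>2 / \<beta>))")
  case True
  interpret prob_space \<rho> by fact
  define m where "m = (\<integral>t. v t \<partial>\<rho>)"
  define E where "E = exp ((norm m)\<^sup>2 / \<beta>)"
  have tangent: "E * (1 + 2 / \<beta> * (m \<bullet> (v t - m))) \<le> exp ((norm (v t))\<^sup>2 / \<beta>)" for t
  proof -
    have "0 \<le> (norm (v t - m))\<^sup>2" by simp
    then have "(norm m)\<^sup>2 + 2 * (m \<bullet> (v t - m)) \<le> (norm (v t))\<^sup>2"
      unfolding power2_norm_eq_inner by (simp add: inner_diff_left inner_diff_right inner_commute)
    then have "((norm m)\<^sup>2 + 2 * (m \<bullet> (v t - m))) / \<beta> \<le> (norm (v t))\<^sup>2 / \<beta>"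
      using \<open>\<beta> > 0\<close> by (intro divide_right_mono) auto
    then have "exp ((norm m)\<^sup>2 / \<beta> + 2 / \<beta> * (m \<bullet> (v t - m))) \<le> exp ((norm (v t))\<^sup>2 / \<beta>)"
      by (simp add: add_divide_distrib)
    moreover have "E * (1 + 2 / \<beta> * (m \<bullet> (v t - m))) \<le>
        exp ((norm m)\<^sup>2 / \<beta> + 2 / \<beta> * (m \<bullet> (v t - m)))"
      unfolding E_def exp_add by (intro mult_left_mono exp_ge_add_one_self) auto
    ultimately show ?thesis by linarith
  qed
  have "(\<integral>t. E * (1 + 2 / \<beta> * (m \<bullet> (v t - m))) \<partial>\<rho>) = E * (1 + 2 / \<beta> * (m \<bullet> (m - m)))"
    using iv unfolding inner_diff_right
    by (simp add: prob_space integral_inner_right[OF iv] flip: m_def)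
  then have "E = (\<integral>t. E * (1 + 2 / \<beta> * (m \<bullet> (v t - m))) \<partial>\<rho>)" by simp
  also have "\<dots> \<le> (\<integral>t. exp ((norm (v t))\<^sup>2 / \<beta>) \<partial>\<rho>)"
    using True iv by (intro integral_mono tangent) auto
  finally show ?thesis
    using True by (simp add: nn_integral_eq_integral E_def m_def ennreal_leI)
next
  case False
  have [measurable]: "v \<in> borel_measurable \<rho>" using iv by auto
  have "(\<integral>\<^sup>+t. ennreal (exp ((norm (v t))\<^sup>2 / \<beta>)) \<partial>\<rho>) = \<infinity>"
  proof (rule ccontr)
    assume "\<not> ?thesis"
    then have "integrable \<rho> (\<lambda>t. exp ((norm (v t))\<^sup>2 / \<beta>))"
      by (intro integrableI_nonneg) (auto simp: top.not_eq_extremum)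
    with False show False by simp
  qed
  then show ?thesis by simp
qed

lemma Cauchy_Schwarz_exp:
  fixes a b :: "'t \<Rightarrow> real"
  assumes [measurable]: "a \<in> borel_measurable \<pi>" "b \<in> borel_measurable \<pi>"
  shows "(\<integral>\<^sup>+t. ennreal (exp ((a t + b t) / 2)) \<partial>\<pi>)\<^sup>2
    \<le> (\<integral>\<^sup>+t. ennreal (exp (a t)) \<partial>\<pi>) * (\<integral>\<^sup>+t. ennreal (exp (b t)) \<partial>\<pi>)"
proof -
  have *: "(ennreal (exp (x / 2)))\<^sup>2 = ennreal (exp x)" for x :: real
    by (simp add: ennreal_power exp_double[symmetric])
  have "(\<integral>\<^sup>+t. ennreal (exp ((a t + b t) / 2)) \<partial>\<pi>)
    = (\<integral>\<^sup>+t. ennreal (exp (a t / 2)) * ennreal (exp (b t / 2)) \<partial>\<pi>)"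
    by (simp add: ennreal_mult'[symmetric] mult_exp_exp add_divide_distrib)
  then show ?thesis
    using Cauchy_Schwarz_nn_integral[of "\<lambda>t. ennreal (exp (a t / 2))" \<pi> "\<lambda>t. ennreal (exp (b t / 2))"]
    by (simp add: *)
qed

section \<open>Norms, traces and measurability of matrix expressions\<close>

lemma norm_add_square_le:
  fixes x y :: "'a::real_inner"
  shows "(norm (x + y))\<^sup>2 \<le> 2 * (norm x)\<^sup>2 + 2 * (norm y)\<^sup>2"
proof -
  have "0 \<le> (norm (x - y))\<^sup>2" by simp
  then show ?thesis
    unfolding power2_norm_eq_inner
    by (simp add: inner_add_left inner_add_right inner_diff_left inner_diff_right inner_commute)
qed

lemma measurable_vec_nth [measurable]:
  fixes f :: "'s \<Rightarrow> 'a::euclidean_space ^ 'n"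
  assumes [measurable]: "f \<in> borel_measurable N"
  shows "(\<lambda>x. f x $ i) \<in> borel_measurable N"
proof -
  have "(\<lambda>v::'a ^ 'n. v $ i) \<in> borel_measurable borel"
    by (intro borel_measurable_continuous_onI continuous_intros)
  from measurable_compose[OF assms this] show ?thesis .
qed

lemma measurable_matrix_vector_mult [measurable (raw)]:
  fixes f :: "'s \<Rightarrow> real ^ 'n ^ 'm" and g :: "'s \<Rightarrow> real ^ 'n"
  assumes [measurable]: "f \<in> borel_measurable N" "g \<in> borel_measurable N"
  shows "(\<lambda>x. f x *v g x) \<in> borel_measurable N"
proof -
  have "f x *v g x = (\<Sum>i\<in>UNIV. (f x $ i \<bullet> g x) *\<^sub>R axis i 1)" for x
    by (simp add: vec_eq_iff matrix_vector_mul_component axis_def if_distrib cong: if_cong)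
  then show ?thesis by simp
qed

lemma measurable_trace [measurable (raw)]:
  fixes f :: "'s \<Rightarrow> real ^ 'n ^ 'n"
  assumes [measurable]: "f \<in> borel_measurable N"
  shows "(\<lambda>x. trace (f x)) \<in> borel_measurable N"
  unfolding trace_def by measurable

lemma measurable_trace_square [measurable (raw)]:
  fixes f :: "'s \<Rightarrow> real ^ 'n ^ 'n"
  assumes [measurable]: "f \<in> borel_measurable N"
  shows "(\<lambda>x. trace (f x ** f x)) \<in> borel_measurable N"
  by (simp add: trace_def matrix_matrix_mult_def)

lemma trace_nonneg:
  fixes A :: "real ^ 'n ^ 'n"
  assumes "psd_matrix A"
  shows "0 \<le> trace A"
  unfolding trace_def
proof (rule sum_nonneg)
  fix i :: 'n
  have "0 \<le> axis i 1 \<bullet> (A *v axis i 1)" using assms by (simp add: psd_matrix_def)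
  then show "0 \<le> A $ i $ i"
    by (simp add: inner_axis' matrix_vector_mul_component inner_axis)
qed

lemma trace_square_eq_frobenius:
  fixes A :: "real ^ 'n ^ 'n"
  assumes "transpose A = A"
  shows "trace (A ** A) = (\<Sum>i\<in>UNIV. (norm (A $ i))\<^sup>2)"
proof -
  have "A $ j $ i = A $ i $ j" for i j
    using assms by (metis transpose_def vec_lambda_beta)
  then show ?thesis
    by (simp add: trace_def matrix_matrix_mult_def power2_norm_eq_inner inner_vec_def)
qed

lemma norm_matrix_vector_le_frobenius:
  fixes A :: "real ^ 'n ^ 'n"
  assumes "transpose A = A"
  shows "(norm (A *v v))\<^sup>2 \<le> (norm v)\<^sup>2 * trace (A ** A)"
proof -
  have "(norm (A *v v))\<^sup>2 = (\<Sum>i\<in>UNIV. (A $ i \<bullet> v)\<^sup>2)"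
    unfolding power2_norm_eq_inner inner_vec_def[of "A *v v"]
    by (simp add: matrix_vector_mul_component power2_eq_square)
  also have "\<dots> \<le> (\<Sum>i\<in>UNIV. (norm (A $ i))\<^sup>2 * (norm v)\<^sup>2)"
    by (intro sum_mono) (metis Cauchy_Schwarz_ineq power2_norm_eq_inner)
  finally show ?thesis
    by (simp add: trace_square_eq_frobenius[OF assms] sum_distrib_left mult.commute)
qed

text \<open>The Frobenius bound makes \<open>norm v\<close> an admissible constant.  The set of admissible constants
  is closed and bounded below, so the least one is its infimum and is itself admissible.\<close>

lemma modified_sup_norm_bound:
  fixes A :: "'t \<Rightarrow> real ^ 'n ^ 'n"
  assumes sym: "\<And>t. t \<in> T \<Longrightarrow> transpose (A t) = A t" and "t \<in> T"
  shows "(norm (A t *v v))\<^sup>2 \<le> (modified_sup_norm T A v)\<^sup>2 * trace (A t ** A t)"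
proof -
  define X where "X = {C. 0 \<le> C \<and> (\<forall>t\<in>T. (norm (A t *v v))\<^sup>2 \<le> C\<^sup>2 * trace (A t ** A t))}"
  have "norm v \<in> X"
    using norm_matrix_vector_le_frobenius sym by (auto simp: X_def)
  moreover have "bdd_below X" by (auto simp: X_def intro: bdd_belowI[of _ 0])
  moreover have "closed X"
  proof -
    have "X = {0..} \<inter> (\<Inter>t\<in>T. {C. (norm (A t *v v))\<^sup>2 \<le> C\<^sup>2 * trace (A t ** A t)})"
      by (auto simp: X_def)
    also have "closed \<dots>"
      by (intro closed_Int closed_INT closed_atLeast ballI closed_Collect_le continuous_intros)
    finally show ?thesis .
  qed
  ultimately have Inf: "Inf X \<in> X" by (intro closed_contains_Inf) auto
  have "modified_sup_norm T A v = (LEAST C. C \<in> X)"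
    by (simp add: modified_sup_norm_def X_def)
  also have "\<dots> = Inf X"
    using Inf \<open>bdd_below X\<close> by (intro Least_equality cInf_lower)
  finally show ?thesis using Inf \<open>t \<in> T\<close> by (auto simp: X_def)
qed

section \<open>The oracle inequality\<close>

text \<open>The hypotheses of the theorem are collected in a locale.  In it, \<open>w\<close> stands for a value of
  the noise; bounds that hold for each such value are separated from the probabilistic ones.\<close>

locale penalized_affine_aggregation =
  fixes P :: "'w measure"
    and M :: "'t measure"
    and W :: "'w \<Rightarrow> real^'n"
    and f0 b :: "real^'n"
    and A :: "'t \<Rightarrow> real^'n^'n"
    and bt :: "'t \<Rightarrow> real^'n"
    and pen :: "'t \<Rightarrow> real"
    and \<pi> :: "'t measure"
    and \<sigma> \<beta> :: real
  assumes prob_P: "prob_space P"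
    and noise: "centred_subgaussian P W \<sigma>"
    and prior: "\<pi> \<in> space (prob_algebra M)"
    and A_meas: "A \<in> borel_measurable M"
    and bt_meas: "bt \<in> borel_measurable M"
    and pen_meas: "pen \<in> borel_measurable M"
    and psd: "\<forall>t\<in>space M. psd_matrix (A t)"
    and contraction: "(SUP t\<in>space M. ereal (onorm ((*v) (A t)))) \<le> 1"
    and temperature: "\<beta> > 4 * \<sigma>\<^sup>2"
    and penalty: "\<forall>t\<in>space M. pen t \<ge> 4 * \<sigma>\<^sup>2 / (\<beta> - 4 * \<sigma>\<^sup>2) *
           (\<sigma>\<^sup>2 * trace (A t ** A t) + 2 * bias_term (space M) A b bt f0 t)"
begin

abbreviation bias :: "'t \<Rightarrow> real" where "bias \<equiv> bias_term (space M) A b bt f0"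
abbreviation fit :: "real^'n \<Rightarrow> 't \<Rightarrow> real^'n" where "fit w t \<equiv> affine_estimator A b bt t (f0 + w)"
abbreviation ewa :: "real^'n \<Rightarrow> real^'n" where "ewa w \<equiv> f_EWA \<sigma> \<beta> \<pi> A b bt pen (f0 + w)"
abbreviation risk :: "real^'n \<Rightarrow> 't \<Rightarrow> real" where "risk w \<equiv> penalized_risk \<sigma> A b bt pen (f0 + w)"

definition signal :: "'t \<Rightarrow> real^'n" where "signal t = A t *v (f0 - b) + bt t"
definition loss :: "real^'n \<Rightarrow> 't \<Rightarrow> real" where "loss w t = (norm (f0 - fit w t))\<^sup>2"
definition comparison_price :: "'t \<Rightarrow> real" where
  "comparison_price t = 8 * \<sigma>\<^sup>2 / (\<beta> - 4 * \<sigma>\<^sup>2) * bias t"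
definition price :: "'t \<Rightarrow> real" where
  "price t = pen t + 2 * \<sigma>\<^sup>2 * trace (A t) + comparison_price t"

text \<open>Up to a quantity that does not depend on \<open>t\<close>, the loss exceeds the penalised risk by
  \<open>\<beta> * aggregation_excess\<close>, and \<open>\<beta> * comparison_excess\<close> is the negative of its linear part,
  compensated by \<open>comparison_price\<close> in place of the penalty.  The quadratic form
  at the comparison point enters with a favourable sign and is dropped.\<close>

definition aggregation_excess :: "real^'n \<Rightarrow> 't \<Rightarrow> real" where
  "aggregation_excess w t =
    (2 * (w \<bullet> signal t) + 2 * (w \<bullet> (A t *v w)) - 2 * \<sigma>\<^sup>2 * trace (A t) - pen t) / \<beta>"
definition comparison_excess :: "real^'n \<Rightarrow> 't \<Rightarrow> real" where
  "comparison_excess w s = (- 2 * (w \<bullet> signal s) - comparison_price s) / \<beta>"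

text \<open>The product of two exponential averages that pays for the whole deviation of the noise:
  the first factor serves the exponential weights, the second all comparison measures \<open>\<mu>\<close>
  simultaneously.\<close>

definition deviation :: "real^'n \<Rightarrow> ennreal" where
  "deviation w = (\<integral>\<^sup>+t. ennreal (exp (aggregation_excess w t)) \<partial>\<pi>) *
     (\<integral>\<^sup>+s. ennreal (exp (comparison_excess w s)) \<partial>\<pi>)"

text \<open>The normalising constant of the Gibbs measure that minimises the right-hand side of the
  oracle inequality over \<open>\<mu>\<close>.  The factor 2 reflects that the divergence of \<open>\<mu>\<close> is paid twice,
  once for the optimality of the exponential weights and once for the noise at \<open>\<mu>\<close>.\<close>

definition partition_function :: "real^'n \<Rightarrow> real" where
  "partition_function w = (\<integral>t. exp (- ((loss w t + price t) / (2 * \<beta>))) \<partial>\<pi>)"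

lemma prob_prior: "prob_space \<pi>" and sets_prior: "sets \<pi> = sets M"
  using prior by (auto simp: space_prob_algebra)

lemma space_prior: "space \<pi> = space M"
  using sets_prior by (rule sets_eq_imp_space_eq)

declare sets_prior [measurable_cong]
declare A_meas [measurable] bt_meas [measurable] pen_meas [measurable]

lemma W_meas [measurable]: "W \<in> borel_measurable P"
  using noise by (simp add: centred_subgaussian_def)

lemma beta_pos: "\<beta> > 0"
  using temperature zero_le_power2[of \<sigma>] by linarith

lemma gap_pos: "\<beta> - 4 * \<sigma>\<^sup>2 > 0"
  using temperature by simp

lemma symmetric: "t \<in> space M \<Longrightarrow> transpose (A t) = A t"
  using psd by (simp add: psd_matrix_def)

lemma onorm_le_1: "t \<in> space M \<Longrightarrow> onorm ((*v) (A t)) \<le> 1"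
  using contraction by (simp add: SUP_le_iff)

lemma trace_square_nonneg: "t \<in> space M \<Longrightarrow> 0 \<le> trace (A t ** A t)"
  by (simp add: trace_square_eq_frobenius symmetric sum_nonneg)

lemma bias_nonneg: "t \<in> space M \<Longrightarrow> 0 \<le> bias t"
  by (simp add: bias_term_def trace_square_nonneg)

lemma pen_nonneg: "t \<in> space M \<Longrightarrow> 0 \<le> pen t"
proof -
  assume t: "t \<in> space M"
  have "0 \<le> 4 * \<sigma>\<^sup>2 / (\<beta> - 4 * \<sigma>\<^sup>2) * (\<sigma>\<^sup>2 * trace (A t ** A t) + 2 * bias t)"
    using gap_pos trace_square_nonneg[OF t] bias_nonneg[OF t] by (intro mult_nonneg_nonneg) auto
  then show "0 \<le> pen t" using penalty t by fastforce
qed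

lemma comparison_price_nonneg: "t \<in> space M \<Longrightarrow> 0 \<le> comparison_price t"
  using gap_pos bias_nonneg by (simp add: comparison_price_def)

lemma price_nonneg: "t \<in> space M \<Longrightarrow> 0 \<le> price t"
  using psd by (simp add: price_def pen_nonneg comparison_price_nonneg trace_nonneg)

lemma loss_nonneg: "0 \<le> loss w t"
  by (simp add: loss_def)

lemma norm_signal_le: "t \<in> space M \<Longrightarrow> (norm (signal t))\<^sup>2 \<le> 2 * bias t"
proof -
  assume t: "t \<in> space M"
  have "(norm (signal t))\<^sup>2 \<le> 2 * (norm (A t *v (f0 - b)))\<^sup>2 + 2 * (norm (bt t))\<^sup>2"
    unfolding signal_def by (rule norm_add_square_le)
  then show ?thesis
    using modified_sup_norm_bound[of "space M" A t "f0 - b"] symmetric t by (simp add: bias_term_def)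
qed

lemma bias_meas [measurable]: "bias \<in> borel_measurable M"
  unfolding bias_term_def by measurable

lemma signal_meas [measurable]: "signal \<in> borel_measurable M"
  unfolding signal_def by measurable

lemma price_meas [measurable]: "price \<in> borel_measurable M" "comparison_price \<in> borel_measurable M"
  unfolding price_def comparison_price_def by measurable

lemma fit_meas [measurable]: "(\<lambda>(\<omega>, t). fit (W \<omega>) t) \<in> borel_measurable (P \<Otimes>\<^sub>M M)"
  unfolding affine_estimator_def by measurable

lemma fit_meas' [measurable]: "fit w \<in> borel_measurable M"
  unfolding affine_estimator_def by measurable

lemma loss_meas [measurable]: "(\<lambda>(\<omega>, t). loss (W \<omega>) t) \<in> borel_measurable (P \<Otimes>\<^sub>M M)"
  unfolding loss_def affine_estimator_def by measurable

lemma loss_meas' [measurable]: "loss w \<in> borel_measurable M"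
  unfolding loss_def affine_estimator_def by measurable

lemma risk_meas [measurable]: "(\<lambda>(\<omega>, t). risk (W \<omega>) t) \<in> borel_measurable (P \<Otimes>\<^sub>M M)"
  unfolding penalized_risk_def risk_estimate_def affine_estimator_def by measurable

lemma risk_meas' [measurable]: "risk w \<in> borel_measurable M"
  unfolding penalized_risk_def risk_estimate_def affine_estimator_def by measurable

lemma excess_meas [measurable]:
  "(\<lambda>(\<omega>, t). aggregation_excess (W \<omega>) t) \<in> borel_measurable (P \<Otimes>\<^sub>M M)"
  "(\<lambda>(\<omega>, t). comparison_excess (W \<omega>) t) \<in> borel_measurable (P \<Otimes>\<^sub>M M)"
  unfolding aggregation_excess_def comparison_excess_def by measurable

lemma excess_meas' [measurable]:
  "aggregation_excess w \<in> borel_measurable M" "comparison_excess w \<in> borel_measurable M"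
  unfolding aggregation_excess_def comparison_excess_def by measurable

lemma partition_function_meas [measurable]: "(\<lambda>\<omega>. partition_function (W \<omega>)) \<in> borel_measurable P"
proof -
  interpret prob_space \<pi> by (rule prob_prior)
  show ?thesis unfolding partition_function_def by measurable
qed

lemma deviation_meas [measurable]: "(\<lambda>\<omega>. deviation (W \<omega>)) \<in> borel_measurable P"
proof -
  interpret prob_space \<pi> by (rule prob_prior)
  show ?thesis unfolding deviation_def by measurable
qed

lemma risk_lower_bound:
  assumes "t \<in> space M"
  shows "(norm (f0 + w - fit w t))\<^sup>2 - real CARD('n) * \<sigma>\<^sup>2 \<le> risk w t"
proof -
  have "0 \<le> 2 * \<sigma>\<^sup>2 * trace (A t)"
    using trace_nonneg psd assms by (intro mult_nonneg_nonneg) auto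
  then show ?thesis
    using pen_nonneg[OF assms] by (simp add: penalized_risk_def risk_estimate_def)
qed

lemma integrable_exp_risk: "integrable \<pi> (\<lambda>t. exp (- (risk w t / \<beta>)))"
proof (rule integrable_exp_uminus[OF prob_prior])
  fix t assume "t \<in> space \<pi>"
  then have "- (real CARD('n) * \<sigma>\<^sup>2) \<le> risk w t"
    using risk_lower_bound[of t w] zero_le_power2[of "norm (f0 + w - fit w t)"]
    unfolding space_prior by linarith
  then show "- (real CARD('n) * \<sigma>\<^sup>2) / \<beta> \<le> risk w t / \<beta>"
    using beta_pos by (intro divide_right_mono) auto
qed measurable

lemma ewa_eq: "ewa w = (\<integral>t. (exp (- (risk w t / \<beta>)) / (\<integral>t. exp (- (risk w t / \<beta>)) \<partial>\<pi>)) *\<^sub>R fit w t \<partial>\<pi>)"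
  unfolding f_EWA_def EWA_measure_def
  by (subst integral_density) (auto simp: Bochner_Integration.integral_nonneg)

lemma ewa_meas [measurable]: "(\<lambda>\<omega>. ewa (W \<omega>)) \<in> borel_measurable P"
proof -
  interpret prob_space \<pi> by (rule prob_prior)
  show ?thesis unfolding ewa_eq by measurable
qed

text \<open>Expanding the residual around the noise: the cross term \<open>2 * (w \<bullet> (f0 - fit w t))\<close> is the only
  noise contribution that depends on \<open>t\<close>, and \<open>2 * \<sigma>\<^sup>2 * trace (A t)\<close> offsets its quadratic part.\<close>

lemma loss_minus_risk:
  "loss w t - risk w t = \<beta> * aggregation_excess w t -
    ((norm w)\<^sup>2 + 2 * (w \<bullet> (f0 - b)) - real CARD('n) * \<sigma>\<^sup>2)"
proof -
  define v where "v = f0 - fit w t"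
  have v: "v = (f0 - b) - signal t - A t *v w"
    by (simp add: v_def affine_estimator_def signal_def matrix_vector_right_distrib
        matrix_vector_mult_diff_distrib algebra_simps)
  have "f0 + w - fit w t = w + v" by (simp add: v_def)
  moreover have "(norm (w + v))\<^sup>2 = (norm w)\<^sup>2 + 2 * (w \<bullet> v) + (norm v)\<^sup>2"
    unfolding power2_norm_eq_inner by (simp add: inner_add_left inner_add_right inner_commute)
  ultimately have "(norm (f0 + w - fit w t))\<^sup>2 = (norm w)\<^sup>2 + 2 * (w \<bullet> v) + (norm v)\<^sup>2"
    by (simp only:)
  then show ?thesis
    using beta_pos
    by (simp add: loss_def penalized_risk_def risk_estimate_def aggregation_excess_def
        v_def[symmetric]) (simp add: v inner_diff_right algebra_simps)
qed

text \<open>The deterministic core.  With \<open>R = risk / \<beta>\<close> and \<open>Z\<close> the normalising constant of the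
  exponential weights, Jensen's inequality bounds \<open>exp (norm (f0 - ewa w) ^ 2 / \<beta>) * Z\<close> by the
  \<open>\<pi>\<close>-integral of \<open>exp (loss / \<beta> - R)\<close>, the first factor of \<open>deviation\<close> up to a constant.
  The Cauchy-Schwarz inequality bounds \<open>partition_function\<^sup>2\<close> by \<open>Z\<close> times the second factor, up to the
  inverse constant, because \<open>R - comparison_excess\<close> is at most \<open>(loss + price) / \<beta>\<close> plus a constant:
  the linear noise terms cancel and the quadratic one has a favourable sign.\<close>

lemma exp_ewa_loss_le_deviation:
  "ennreal (exp ((norm (f0 - ewa w))\<^sup>2 / \<beta>) * (partition_function w)\<^sup>2) \<le> deviation w"
proof -
  define c where "c = ((norm w)\<^sup>2 + 2 * (w \<bullet> (f0 - b)) - real CARD('n) * \<sigma>\<^sup>2) / \<beta>"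
  define R where "R t = risk w t / \<beta>" for t
  define Z where "Z = (\<integral>t. exp (- R t) \<partial>\<pi>)"
  define \<rho> where "\<rho> = density \<pi> (\<lambda>t. ennreal (exp (- R t) / Z))"
  define Z1 where "Z1 = (\<integral>\<^sup>+t. ennreal (exp (aggregation_excess w t)) \<partial>\<pi>)"
  define Z2 where "Z2 = (\<integral>\<^sup>+t. ennreal (exp (comparison_excess w t)) \<partial>\<pi>)"
  define S where "S = (norm (f0 - ewa w))\<^sup>2 / \<beta>"
  have [measurable]: "R \<in> borel_measurable M" unfolding R_def by measurable
  interpret pi: prob_space \<pi> by (rule prob_prior)
  have iR: "integrable \<pi> (\<lambda>t. exp (- R t))"
    using integrable_exp_risk by (simp add: R_def)
  have Z: "Z > 0"
    unfolding Z_def using prob_prior iR by (rule integral_exp_pos)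
  have Z_nn: "(\<integral>\<^sup>+t. ennreal (exp (- R t)) \<partial>\<pi>) = ennreal Z"
    unfolding Z_def using iR by (intro nn_integral_eq_integral) auto
  interpret rho: prob_space \<rho>
    unfolding \<rho>_def Z_def using prob_prior iR by (rule prob_space_gibbs_density)
  have loss_R: "loss w t / \<beta> - R t = aggregation_excess w t - c" for t
    using loss_minus_risk[of w t] beta_pos unfolding R_def c_def
    by (simp add: field_simps)
  have "integrable \<rho> (\<lambda>t. f0 + w - fit w t)"
    unfolding \<rho>_def
  proof (rule integrable_gibbs_density[OF prob_prior, where \<beta>=\<beta> and c="real CARD('n) * \<sigma>\<^sup>2 / \<beta>"])
    fix t assume "t \<in> space \<pi>"
    then show "(norm (f0 + w - fit w t))\<^sup>2 / \<beta> - real CARD('n) * \<sigma>\<^sup>2 / \<beta> \<le> R t"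
      using risk_lower_bound[of t w] beta_pos
      by (simp add: R_def space_prior diff_divide_distrib[symmetric] divide_right_mono)
  qed (use beta_pos Z in measurable)
  from Bochner_Integration.integrable_diff[OF rho.integrable_const[of "f0 + w"] this]
  have ifit: "integrable \<rho> (fit w)" by simp
  have iv: "integrable \<rho> (\<lambda>t. f0 - fit w t)"
    using ifit by (intro Bochner_Integration.integrable_diff) auto
  have "ewa w = (\<integral>t. fit w t \<partial>\<rho>)"
    by (simp add: f_EWA_def EWA_measure_def \<rho>_def R_def Z_def)
  then have mean: "(\<integral>t. f0 - fit w t \<partial>\<rho>) = f0 - ewa w"
    using ifit by (simp add: rho.prob_space)

  have "ennreal (exp S) * ennreal Z \<le> (\<integral>\<^sup>+t. ennreal (exp (loss w t / \<beta>)) \<partial>\<rho>) * ennreal Z"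
    using exp_norm_mean_le[OF rho.prob_space_axioms iv beta_pos]
    unfolding mean S_def loss_def by (intro mult_right_mono) auto
  also have "\<dots> = (\<integral>\<^sup>+t. ennreal (exp (- R t) / Z) * ennreal (exp (loss w t / \<beta>)) * ennreal Z \<partial>\<pi>)"
    unfolding \<rho>_def by (subst nn_integral_density) (auto simp: nn_integral_multc)
  also have "\<dots> = (\<integral>\<^sup>+t. ennreal (exp (- c)) * ennreal (exp (aggregation_excess w t)) \<partial>\<pi>)"
  proof (intro nn_integral_cong)
    fix t
    have "exp (- R t) / Z * exp (loss w t / \<beta>) * Z = exp (loss w t / \<beta> - R t)"
      using Z by (simp add: exp_diff exp_minus field_simps)
    also have "\<dots> = exp (- c) * exp (aggregation_excess w t)"
      unfolding loss_R by (simp add: mult_exp_exp)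
    finally show "ennreal (exp (- R t) / Z) * ennreal (exp (loss w t / \<beta>)) * ennreal Z =
        ennreal (exp (- c)) * ennreal (exp (aggregation_excess w t))"
      using Z by (simp add: ennreal_mult[symmetric])
  qed
  also have "\<dots> = ennreal (exp (- c)) * Z1"
    by (simp add: Z1_def nn_integral_cmult)
  finally have jensen: "ennreal (exp S) * ennreal Z \<le> ennreal (exp (- c)) * Z1" .

  have "integrable \<pi> (\<lambda>t. exp (- ((loss w t + price t) / (2 * \<beta>))))"
    using beta_pos loss_nonneg price_nonneg
    by (intro integrable_exp_uminus[where c=0] prob_prior) (auto simp: space_prior)
  then have "ennreal (partition_function w) = (\<integral>\<^sup>+t. ennreal (exp (- ((loss w t + price t) / (2 * \<beta>)))) \<partial>\<pi>)"
    unfolding partition_function_def by (intro nn_integral_eq_integral[symmetric]) auto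
  also have "\<dots> \<le> (\<integral>\<^sup>+t. ennreal (exp (c / 2)) *
      ennreal (exp ((- R t + comparison_excess w t) / 2)) \<partial>\<pi>)"
  proof (intro nn_integral_mono)
    fix t assume "t \<in> space \<pi>"
    then have t: "t \<in> space M" by (simp add: space_prior)
    have "0 \<le> w \<bullet> (A t *v w)" using psd t by (simp add: psd_matrix_def)
    then have "\<beta> * (aggregation_excess w t + comparison_excess w t) \<ge>
        - price t"
      using beta_pos
      by (simp add: aggregation_excess_def comparison_excess_def price_def distrib_left)
    then have "- (price t / \<beta>) \<le> aggregation_excess w t + comparison_excess w t"
      using beta_pos by (simp add: field_simps)
    moreover define l p where "l = loss w t / \<beta>" and "p = price t / \<beta>"
    ultimately have "- p \<le> aggregation_excess w t + comparison_excess w t"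
      and "l - R t = aggregation_excess w t - c"
      using loss_R[of t] by simp_all
    then have "- ((l + p) / 2) \<le> c / 2 + (- R t + comparison_excess w t) / 2"
      by (simp add: field_simps)
    moreover have "(loss w t + price t) / (2 * \<beta>) = (l + p) / 2"
      by (simp add: l_def p_def add_divide_distrib)
    ultimately have "- ((loss w t + price t) / (2 * \<beta>)) \<le> c / 2 + (- R t + comparison_excess w t) / 2"
      by (simp only:)
    then show "ennreal (exp (- ((loss w t + price t) / (2 * \<beta>)))) \<le>
        ennreal (exp (c / 2)) * ennreal (exp ((- R t + comparison_excess w t) / 2))"
      by (simp add: ennreal_mult'[symmetric] mult_exp_exp ennreal_leI)
  qed
  also have "\<dots> = ennreal (exp (c / 2)) * (\<integral>\<^sup>+t. ennreal (exp ((- R t + comparison_excess w t) / 2)) \<partial>\<pi>)"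
    by (intro nn_integral_cmult) measurable
  finally have "(ennreal (partition_function w))\<^sup>2 \<le> (ennreal (exp (c / 2)) *
      (\<integral>\<^sup>+t. ennreal (exp ((- R t + comparison_excess w t) / 2)) \<partial>\<pi>))\<^sup>2"
    by (intro power_mono) auto
  also have "\<dots> = ennreal (exp c) * (\<integral>\<^sup>+t. ennreal (exp ((- R t + comparison_excess w t) / 2)) \<partial>\<pi>)\<^sup>2"
    by (simp add: power_mult_distrib ennreal_power exp_double[symmetric])
  also have "\<dots> \<le> ennreal (exp c) * (ennreal Z * Z2)"
    unfolding Z_nn[symmetric] Z2_def
    by (intro mult_left_mono Cauchy_Schwarz_exp) (auto, measurable)
  finally have cs: "(ennreal (partition_function w))\<^sup>2 \<le> ennreal (exp c) * (ennreal Z * Z2)" .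

  have "0 \<le> partition_function w" unfolding partition_function_def by (intro Bochner_Integration.integral_nonneg) simp
  then have "ennreal (exp S * (partition_function w)\<^sup>2) = ennreal (exp S) * (ennreal (partition_function w))\<^sup>2"
    by (simp add: ennreal_mult ennreal_power)
  also have "\<dots> \<le> ennreal (exp S) * (ennreal (exp c) * (ennreal Z * Z2))"
    using cs by (rule mult_left_mono) simp
  also have "\<dots> = ennreal (exp c) * (ennreal (exp S) * ennreal Z) * Z2"
    by (simp only: mult_ac)
  also have "\<dots> \<le> ennreal (exp c) * (ennreal (exp (- c)) * Z1) * Z2"
    using jensen by (intro mult_right_mono mult_left_mono) auto
  also have "\<dots> = Z1 * Z2"
    by (simp add: mult.assoc[symmetric] ennreal_mult'[symmetric] mult_exp_exp)
  finally show ?thesis by (simp add: S_def deviation_def Z1_def Z2_def)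
qed

text \<open>For a fixed pair \<open>(t, s)\<close> the linear part of the exponent is \<open>2 / \<beta> * (signal t - signal s)\<close>
  and the quadratic part is that of \<open>t\<close>.  The bound on the squared linear part splits between
  the penalty at \<open>t\<close> and \<open>comparison_price\<close> at \<open>s\<close>; the second-order trace term
  is absorbed by the remainder of the penalty.\<close>

lemma excess_exponential_moment:
  assumes t: "t \<in> space M" and s: "s \<in> space M"
  shows "(\<integral>\<^sup>+\<omega>. ennreal (exp (aggregation_excess (W \<omega>) t + comparison_excess (W \<omega>) s)) \<partial>P) \<le> 1"
proof -
  define u where "u = signal t - signal s"
  define \<kappa> where "\<kappa> = \<beta> - 4 * \<sigma>\<^sup>2"
  define K where "K = (2 * \<sigma>\<^sup>2 * trace (A t) + pen t + comparison_price s) / \<beta>"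

  define E where "E = \<sigma>\<^sup>2 * (norm ((2 / \<beta>) *\<^sub>R u))\<^sup>2 / (2 * (1 - 2 * (2 / \<beta>) * \<sigma>\<^sup>2)) + (2 / \<beta>) * \<sigma>\<^sup>2 * trace (A t)
    + (2 / \<beta>)\<^sup>2 * \<sigma>^4 * trace (A t ** A t) / (1 - 2 * (2 / \<beta>) * \<sigma>\<^sup>2)"
  have \<kappa>: "\<kappa> > 0" using gap_pos by (simp add: \<kappa>_def)
  have gap: "1 - 2 * (2 / \<beta>) * \<sigma>\<^sup>2 = \<kappa> / \<beta>"
    using beta_pos by (simp add: \<kappa>_def field_simps)
  have exponent: "aggregation_excess w t + comparison_excess w s =
      - K + ((2 / \<beta>) *\<^sub>R u \<bullet> w + (2 / \<beta>) * (w \<bullet> (A t *v w)))" for w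
    using beta_pos
    by (simp add: aggregation_excess_def comparison_excess_def K_def u_def inner_diff_left
        inner_commute[of w] add_divide_distrib diff_divide_distrib right_diff_distrib)
  have u: "(norm u)\<^sup>2 \<le> 4 * bias t + 4 * bias s"
    using norm_add_square_le[of "signal t" "- signal s"] norm_signal_le[OF t] norm_signal_le[OF s]
    by (simp add: u_def)
  have "E = (2 * \<sigma>\<^sup>2 * (norm u)\<^sup>2 / \<kappa> + 4 * \<sigma>^4 * trace (A t ** A t) / \<kappa> + 2 * \<sigma>\<^sup>2 * trace (A t)) / \<beta>"
    unfolding E_def gap using beta_pos \<kappa>
    by (simp add: power_mult_distrib power2_eq_square[of \<beta>] power_divide field_simps)
  also have "\<dots> \<le> K"
  proof -
    have "2 * \<sigma>\<^sup>2 * (norm u)\<^sup>2 / \<kappa> \<le> 2 * \<sigma>\<^sup>2 * (4 * bias t + 4 * bias s) / \<kappa>"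
      using u \<kappa> by (intro divide_right_mono mult_left_mono) auto
    moreover have "2 * \<sigma>\<^sup>2 * (4 * bias t + 4 * bias s) / \<kappa> + 4 * \<sigma>^4 * trace (A t ** A t) / \<kappa> =
        4 * \<sigma>\<^sup>2 / \<kappa> * (\<sigma>\<^sup>2 * trace (A t ** A t) + 2 * bias t) + comparison_price s"
      using \<kappa> unfolding comparison_price_def \<kappa>_def[symmetric]
      by (simp add: field_simps power2_eq_square power4_eq_xxxx)
    moreover have "4 * \<sigma>\<^sup>2 / \<kappa> * (\<sigma>\<^sup>2 * trace (A t ** A t) + 2 * bias t) \<le> pen t"
      using penalty t by (simp add: \<kappa>_def)
    ultimately have "2 * \<sigma>\<^sup>2 * (norm u)\<^sup>2 / \<kappa> + 4 * \<sigma>^4 * trace (A t ** A t) / \<kappa> \<le>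
        pen t + comparison_price s"
      by linarith
    then show ?thesis
      unfolding K_def using beta_pos by (intro divide_right_mono) auto
  qed
  finally have EK: "E \<le> K" .
  have "(\<integral>\<^sup>+\<omega>. ennreal (exp (aggregation_excess (W \<omega>) t + comparison_excess (W \<omega>) s)) \<partial>P)
    = (\<integral>\<^sup>+\<omega>. ennreal (exp (- K)) *
        ennreal (exp ((2 / \<beta>) *\<^sub>R u \<bullet> W \<omega> + (2 / \<beta>) * (W \<omega> \<bullet> (A t *v W \<omega>)))) \<partial>P)"
    unfolding exponent exp_add[of "- K"] by (simp add: ennreal_mult')
  also have "\<dots> = ennreal (exp (- K)) *
      (\<integral>\<^sup>+\<omega>. ennreal (exp ((2 / \<beta>) *\<^sub>R u \<bullet> W \<omega> + (2 / \<beta>) * (W \<omega> \<bullet> (A t *v W \<omega>)))) \<partial>P)"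
    by (intro nn_integral_cmult) measurable
  also have "\<dots> \<le> ennreal (exp (- K)) * ennreal (exp E)"
    unfolding E_def
  proof (intro mult_left_mono subgaussian_exp_quadratic_form[OF prob_P noise])
    show "psd_matrix (A t)" using psd t by blast
    show "onorm ((*v) (A t)) \<le> 1" using t by (rule onorm_le_1)
    show "2 * (2 / \<beta>) * \<sigma>\<^sup>2 < 1" using beta_pos temperature by (simp add: field_simps)
  qed (use beta_pos in auto)
  also have "\<dots> \<le> 1"
    using EK by (simp add: ennreal_mult'[symmetric] mult_exp_exp flip: ennreal_1)
  finally show ?thesis .
qed

lemma expected_deviation_le_1: "(\<integral>\<^sup>+\<omega>. deviation (W \<omega>) \<partial>P) \<le> 1"
proof -
  interpret pi: prob_space \<pi> by (rule prob_prior)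
  interpret P: prob_space P by (rule prob_P)
  interpret pp: pair_sigma_finite P \<pi> ..
  have "(\<integral>\<^sup>+\<omega>. deviation (W \<omega>) \<partial>P) = (\<integral>\<^sup>+\<omega>. (\<integral>\<^sup>+t. (\<integral>\<^sup>+s.
      ennreal (exp (aggregation_excess (W \<omega>) t + comparison_excess (W \<omega>) s)) \<partial>\<pi>) \<partial>\<pi>) \<partial>P)"
    unfolding deviation_def
    by (simp add: nn_integral_multc nn_integral_cmult exp_add ennreal_mult)
  also have "\<dots> = (\<integral>\<^sup>+t. (\<integral>\<^sup>+\<omega>. (\<integral>\<^sup>+s.
      ennreal (exp (aggregation_excess (W \<omega>) t + comparison_excess (W \<omega>) s)) \<partial>\<pi>) \<partial>P) \<partial>\<pi>)"
    by (rule pp.Fubini'[symmetric]) measurable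
  also have "\<dots> = (\<integral>\<^sup>+t. (\<integral>\<^sup>+s. (\<integral>\<^sup>+\<omega>.
      ennreal (exp (aggregation_excess (W \<omega>) t + comparison_excess (W \<omega>) s)) \<partial>P) \<partial>\<pi>) \<partial>\<pi>)"
    by (intro nn_integral_cong pp.Fubini'[symmetric]) (simp add: space_prior, measurable)
  also have "\<dots> \<le> (\<integral>\<^sup>+t. (\<integral>\<^sup>+s. 1 \<partial>\<pi>) \<partial>\<pi>)"
    by (intro nn_integral_mono excess_exponential_moment) (auto simp: space_prior)
  also have "\<dots> = 1" by (simp add: pi.emeasure_space_1)
  finally show ?thesis .
qed

lemma partition_function_bounds: "0 < partition_function w" "partition_function w \<le> 1"
proof -
  interpret pi: prob_space \<pi> by (rule prob_prior)
  have nonneg: "0 \<le> (loss w t + price t) / (2 * \<beta>)" if "t \<in> space \<pi>" for t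
    using that beta_pos loss_nonneg[of w t] price_nonneg[of t] by (simp add: space_prior)
  have int: "integrable \<pi> (\<lambda>t. exp (- ((loss w t + price t) / (2 * \<beta>))))"
    by (rule integrable_exp_uminus[OF prob_prior _ nonneg]) measurable
  show "0 < partition_function w"
    unfolding partition_function_def using prob_prior int by (rule integral_exp_pos)
  have "partition_function w \<le> (\<integral>t. 1 \<partial>\<pi>)"
    unfolding partition_function_def using int nonneg by (intro integral_mono) auto
  then show "partition_function w \<le> 1" by (simp add: pi.prob_space)
qed

text \<open>The variational principle for the potential \<open>(loss + price) / (2 * \<beta>)\<close> turns
  \<open>partition_function\<close> into the right-hand side of the oracle inequality.\<close>

lemma nn_integral_potential:
  assumes "sets \<mu> = sets M"
  shows "ennreal (2 * \<beta>) * (\<integral>\<^sup>+t. ennreal ((loss w t + price t) / (2 * \<beta>)) \<partial>\<mu>) =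
    (\<integral>\<^sup>+t. ennreal (loss w t) \<partial>\<mu>) + (\<integral>\<^sup>+t. ennreal (price t) \<partial>\<mu>)"
proof -
  note [measurable_cong] = assms
  have sp: "space \<mu> = space M" using assms by (rule sets_eq_imp_space_eq)
  have "ennreal (2 * \<beta>) * (\<integral>\<^sup>+t. ennreal ((loss w t + price t) / (2 * \<beta>)) \<partial>\<mu>) =
    (\<integral>\<^sup>+t. ennreal (2 * \<beta>) * ennreal ((loss w t + price t) / (2 * \<beta>)) \<partial>\<mu>)"
    by (intro nn_integral_cmult[symmetric]) measurable
  also have "\<dots> = (\<integral>\<^sup>+t. ennreal (loss w t) + ennreal (price t) \<partial>\<mu>)"
  proof (intro nn_integral_cong)
    fix t assume "t \<in> space \<mu>"
    then show "ennreal (2 * \<beta>) * ennreal ((loss w t + price t) / (2 * \<beta>)) =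
        ennreal (loss w t) + ennreal (price t)"
      using beta_pos loss_nonneg[of w t] price_nonneg[of t]
      by (simp add: sp ennreal_mult'[symmetric] ennreal_plus[symmetric] del: ennreal_plus)
  qed
  also have "\<dots> = (\<integral>\<^sup>+t. ennreal (loss w t) \<partial>\<mu>) + (\<integral>\<^sup>+t. ennreal (price t) \<partial>\<mu>)"
    by (intro nn_integral_add) measurable
  finally show ?thesis .
qed

lemma partition_function_le_oracle_bound:
  assumes "\<mu> \<in> space (prob_algebra M)"
  shows "ennreal (- 2 * \<beta> * ln (partition_function w)) \<le>
    (\<integral>\<^sup>+t. ennreal (loss w t) \<partial>\<mu>) + (\<integral>\<^sup>+t. ennreal (price t) \<partial>\<mu>) + 2 * ennreal \<beta> * KL \<mu> \<pi>"
proof -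
  have \<mu>: "prob_space \<mu>" "sets \<mu> = sets M" using assms by (auto simp: space_prob_algebra)
  have "ennreal (- ln (partition_function w)) \<le> (\<integral>\<^sup>+t. ennreal ((loss w t + price t) / (2 * \<beta>)) \<partial>\<mu>) + KL \<mu> \<pi>"
    unfolding partition_function_def
    using beta_pos loss_nonneg price_nonneg \<mu>
    by (intro gibbs_variational_inequality prob_prior)
      (auto simp: space_prior sets_prior intro!: divide_nonneg_pos add_nonneg_nonneg)
  then have "ennreal (2 * \<beta>) * ennreal (- ln (partition_function w)) \<le>
      ennreal (2 * \<beta>) * ((\<integral>\<^sup>+t. ennreal ((loss w t + price t) / (2 * \<beta>)) \<partial>\<mu>) + KL \<mu> \<pi>)"
    by (rule mult_left_mono) simp
  also have "\<dots> = (\<integral>\<^sup>+t. ennreal (loss w t) \<partial>\<mu>) + (\<integral>\<^sup>+t. ennreal (price t) \<partial>\<mu>) + 2 * ennreal \<beta> * KL \<mu> \<pi>"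
    unfolding distrib_left nn_integral_potential[OF \<mu>(2)]
    using beta_pos by (simp add: ennreal_mult)
  also have "ennreal (2 * \<beta>) * ennreal (- ln (partition_function w)) = ennreal (- 2 * \<beta> * ln (partition_function w))"
    using beta_pos by (simp add: ennreal_mult'[symmetric])
  finally show ?thesis .
qed

text \<open>Since the infimum is attained, it equals a measurable function of the noise; the event of
  the oracle inequality, defined through an uncountable infimum, is thereby measurable.\<close>

lemma oracle_bound_eq:
  "(INF \<mu>\<in>space (prob_algebra M). (\<integral>\<^sup>+t. ennreal (loss w t) \<partial>\<mu>) + (\<integral>\<^sup>+t. ennreal (price t) \<partial>\<mu>) +
      ennreal \<beta> * (2 * KL \<mu> \<pi> + k)) = ennreal (- 2 * \<beta> * ln (partition_function w)) + ennreal \<beta> * k"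
  (is "(INF \<mu>\<in>_. ?bound \<mu>) = _")
proof (rule antisym)
  have split: "?bound \<mu> = ((\<integral>\<^sup>+t. ennreal (loss w t) \<partial>\<mu>) + (\<integral>\<^sup>+t. ennreal (price t) \<partial>\<mu>) +
      2 * ennreal \<beta> * KL \<mu> \<pi>) + ennreal \<beta> * k" for \<mu>
    by (simp add: distrib_left mult_ac add_ac)
  show "ennreal (- 2 * \<beta> * ln (partition_function w)) + ennreal \<beta> * k \<le> (INF \<mu>\<in>space (prob_algebra M). ?bound \<mu>)"
    unfolding split by (intro INF_greatest add_right_mono partition_function_le_oracle_bound)
  have potential: "(\<lambda>t. (loss w t + price t) / (2 * \<beta>)) \<in> borel_measurable \<pi>" by measurable
  have "0 \<le> (loss w t + price t) / (2 * \<beta>)" if "t \<in> space \<pi>" for t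
    using that beta_pos loss_nonneg[of w t] price_nonneg[of t] by (simp add: space_prior)
  from gibbs_variational_attained[OF prob_prior potential this]
  obtain \<mu> where \<mu>: "prob_space \<mu>" "sets \<mu> = sets \<pi>"
    "(\<integral>\<^sup>+t. ennreal ((loss w t + price t) / (2 * \<beta>)) \<partial>\<mu>) + KL \<mu> \<pi> = ennreal (- ln (partition_function w))"
    unfolding partition_function_def by blast
  have \<mu>M: "sets \<mu> = sets M" using \<mu>(2) sets_prior by simp
  have "(INF \<mu>\<in>space (prob_algebra M). ?bound \<mu>) \<le> ?bound \<mu>"
    using \<mu>(1) \<mu>M by (intro INF_lower) (simp add: space_prob_algebra)
  also have "\<dots> = ennreal (2 * \<beta>) * ennreal (- ln (partition_function w)) + ennreal \<beta> * k"
    unfolding split \<mu>(3)[symmetric] distrib_left nn_integral_potential[OF \<mu>M]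
    using beta_pos by (simp add: ennreal_mult mult_ac)
  also have "ennreal (2 * \<beta>) * ennreal (- ln (partition_function w)) = ennreal (- 2 * \<beta> * ln (partition_function w))"
    using beta_pos by (simp add: ennreal_mult'[symmetric])
  finally show "(INF \<mu>\<in>space (prob_algebra M). ?bound \<mu>) \<le>
      ennreal (- 2 * \<beta> * ln (partition_function w)) + ennreal \<beta> * k" .
qed

text \<open>By Markov's inequality, \<open>\<eta> * deviation < 1\<close> outside an event of probability at most \<open>\<eta>\<close>.
  There the logarithm of the deterministic bound is the oracle inequality.\<close>

lemma oracle_inequality_in_probability:
  assumes "0 < \<eta>" "\<eta> \<le> 1"
  shows "1 - \<eta> \<le> \<P>(\<omega> in P. ennreal ((norm (f0 - ewa (W \<omega>)))\<^sup>2) \<le>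
    (INF \<mu>\<in>space (prob_algebra M). (\<integral>\<^sup>+t. ennreal (loss (W \<omega>) t) \<partial>\<mu>) + (\<integral>\<^sup>+t. ennreal (price t) \<partial>\<mu>) +
      ennreal \<beta> * (2 * KL \<mu> \<pi> + ennreal (ln (1 / \<eta>)))))"
proof -
  interpret P: prob_space P by (rule prob_P)
  define bad where "bad = {\<omega> \<in> space P. 1 \<le> ennreal \<eta> * deviation (W \<omega>)}"
  define good where "good = {\<omega> \<in> space P. ennreal ((norm (f0 - ewa (W \<omega>)))\<^sup>2) \<le>
    ennreal (- 2 * \<beta> * ln (partition_function (W \<omega>))) + ennreal \<beta> * ennreal (ln (1 / \<eta>))}"
  have [measurable]: "bad \<in> sets P" "good \<in> sets P"
    unfolding bad_def good_def by measurable
  have "emeasure P bad \<le> ennreal \<eta> * (\<integral>\<^sup>+\<omega>. deviation (W \<omega>) * indicator (space P) \<omega> \<partial>P)"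
    unfolding bad_def by (rule nn_integral_Markov_inequality) auto
  also have "(\<integral>\<^sup>+\<omega>. deviation (W \<omega>) * indicator (space P) \<omega> \<partial>P) = (\<integral>\<^sup>+\<omega>. deviation (W \<omega>) \<partial>P)"
    by (intro nn_integral_cong) simp
  also have "ennreal \<eta> * (\<integral>\<^sup>+\<omega>. deviation (W \<omega>) \<partial>P) \<le> ennreal \<eta> * 1"
    using expected_deviation_le_1 by (rule mult_left_mono) simp
  finally have "P.prob bad \<le> \<eta>"
    using assms by (simp add: P.emeasure_eq_measure)
  have "space P - bad \<subseteq> good"
  proof
    fix \<omega> assume \<omega>: "\<omega> \<in> space P - bad"
    define S where "S = (norm (f0 - ewa (W \<omega>)))\<^sup>2"
    define V where "V = partition_function (W \<omega>)"
    have V: "0 < V" "V \<le> 1" using partition_function_bounds by (auto simp: V_def)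
    have "ennreal \<eta> * ennreal (exp (S / \<beta>) * V\<^sup>2) \<le> ennreal \<eta> * deviation (W \<omega>)"
      unfolding S_def V_def by (intro mult_left_mono exp_ewa_loss_le_deviation) simp
    also have "\<dots> \<le> 1" using \<omega> by (auto simp: bad_def)
    finally have "\<eta> * (exp (S / \<beta>) * V\<^sup>2) \<le> 1"
      using assms by (simp add: ennreal_mult'[symmetric] flip: ennreal_1)
    then have "ln (\<eta> * (exp (S / \<beta>) * V\<^sup>2)) \<le> 0"
      using V assms by (subst ln_le_zero_iff) auto
    then have "S / \<beta> \<le> - 2 * ln V + ln (1 / \<eta>)"
      using V assms by (simp add: ln_mult ln_div ln_realpow)
    then have "S \<le> - 2 * \<beta> * ln V + \<beta> * ln (1 / \<eta>)"
      using beta_pos by (simp add: field_simps)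
    moreover have "0 \<le> - 2 * \<beta> * ln V" "0 \<le> \<beta> * ln (1 / \<eta>)"
      using V assms beta_pos by (auto simp: mult_nonneg_nonpos)
    ultimately have "ennreal S \<le> ennreal (- 2 * \<beta> * ln V) + ennreal \<beta> * ennreal (ln (1 / \<eta>))"
      using beta_pos by (simp add: ennreal_mult'[symmetric] ennreal_plus[symmetric] ennreal_leI del: ennreal_plus)
    then show "\<omega> \<in> good" using \<omega> by (simp add: good_def S_def V_def)
  qed
  then have "P.prob (space P - bad) \<le> P.prob good"
    by (intro P.finite_measure_mono) measurable
  moreover have "P.prob (space P - bad) = 1 - P.prob bad"
    by (intro P.prob_compl) measurable
  ultimately have "1 - \<eta> \<le> P.prob good" using \<open>P.prob bad \<le> \<eta>\<close> by linarith
  then show ?thesis unfolding oracle_bound_eq good_def .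
qed

text \<open>The bound \<open>1 + x \<le> exp x\<close> linearises the deterministic bound before expectations are taken.
  The terms on both sides then stay nonnegative, and the constant \<open>\<beta>\<close> cancels against
  \<open>\<beta>\<close> times the expected deviation.\<close>

lemma oracle_inequality_in_expectation:
  assumes \<mu>: "\<mu> \<in> space (prob_algebra M)"
  shows "(\<integral>\<^sup>+\<omega>. ennreal ((norm (f0 - ewa (W \<omega>)))\<^sup>2) \<partial>P) \<le>
    (\<integral>\<^sup>+t. (\<integral>\<^sup>+\<omega>. ennreal (loss (W \<omega>) t) \<partial>P) \<partial>\<mu>) + (\<integral>\<^sup>+t. ennreal (price t) \<partial>\<mu>) + 2 * ennreal \<beta> * KL \<mu> \<pi>"
proof -
  interpret P: prob_space P by (rule prob_P)
  interpret mu: prob_space \<mu> using \<mu> by (simp add: space_prob_algebra)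
  interpret pp: pair_sigma_finite P \<mu> ..
  have [measurable_cong]: "sets \<mu> = sets M" using \<mu> by (simp add: space_prob_algebra)
  define q where "q = (\<integral>\<^sup>+t. ennreal (price t) \<partial>\<mu>) + 2 * ennreal \<beta> * KL \<mu> \<pi>"
  have "ennreal \<beta> + ennreal ((norm (f0 - ewa w))\<^sup>2) \<le>
    ennreal \<beta> * deviation w + ((\<integral>\<^sup>+t. ennreal (loss w t) \<partial>\<mu>) + q)" for w
  proof -
    define S where "S = (norm (f0 - ewa w))\<^sup>2"
    define V where "V = partition_function w"
    have V: "0 < V" "V \<le> 1" using partition_function_bounds by (auto simp: V_def)
    have "1 + (S / \<beta> + 2 * ln V) \<le> exp (S / \<beta> + 2 * ln V)" by (rule exp_ge_add_one_self)
    also have "\<dots> = exp (S / \<beta>) * V\<^sup>2"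
      using V by (simp add: exp_add exp_double)
    finally have "\<beta> * (1 + (S / \<beta> + 2 * ln V)) \<le> \<beta> * (exp (S / \<beta>) * V\<^sup>2)"
      using beta_pos by (intro mult_left_mono) auto
    moreover have "\<beta> * (1 + (S / \<beta> + 2 * ln V)) = \<beta> + S + 2 * \<beta> * ln V"
      using beta_pos by (simp add: distrib_left)
    ultimately have "\<beta> + S \<le> \<beta> * (exp (S / \<beta>) * V\<^sup>2) + - 2 * \<beta> * ln V"
      by simp
    moreover have "0 \<le> - 2 * \<beta> * ln V" "0 \<le> S"
      using V beta_pos by (auto simp: mult_nonneg_nonpos S_def)
    ultimately have "ennreal \<beta> + ennreal S \<le>
        ennreal \<beta> * ennreal (exp (S / \<beta>) * V\<^sup>2) + ennreal (- 2 * \<beta> * ln V)"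
      using beta_pos
      by (simp add: ennreal_mult'[symmetric] ennreal_plus[symmetric] ennreal_leI del: ennreal_plus)
    also have "\<dots> \<le> ennreal \<beta> * deviation w +
        ((\<integral>\<^sup>+t. ennreal (loss w t) \<partial>\<mu>) + (\<integral>\<^sup>+t. ennreal (price t) \<partial>\<mu>) + 2 * ennreal \<beta> * KL \<mu> \<pi>)"
      unfolding S_def V_def
      by (intro add_mono mult_left_mono exp_ewa_loss_le_deviation partition_function_le_oracle_bound \<mu>) simp
    finally show ?thesis by (simp add: S_def q_def add.assoc)
  qed
  then have "(\<integral>\<^sup>+\<omega>. ennreal \<beta> + ennreal ((norm (f0 - ewa (W \<omega>)))\<^sup>2) \<partial>P) \<le>
      (\<integral>\<^sup>+\<omega>. ennreal \<beta> * deviation (W \<omega>) + ((\<integral>\<^sup>+t. ennreal (loss (W \<omega>) t) \<partial>\<mu>) + q) \<partial>P)"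
    by (intro nn_integral_mono)
  also have "\<dots> = ennreal \<beta> * (\<integral>\<^sup>+\<omega>. deviation (W \<omega>) \<partial>P) +
      ((\<integral>\<^sup>+\<omega>. (\<integral>\<^sup>+t. ennreal (loss (W \<omega>) t) \<partial>\<mu>) \<partial>P) + q)"
    by (simp add: nn_integral_add nn_integral_cmult P.emeasure_space_1)
  also have "\<dots> \<le> ennreal \<beta> * 1 + ((\<integral>\<^sup>+\<omega>. (\<integral>\<^sup>+t. ennreal (loss (W \<omega>) t) \<partial>\<mu>) \<partial>P) + q)"
    by (intro add_right_mono mult_left_mono expected_deviation_le_1) simp
  also have "(\<integral>\<^sup>+\<omega>. (\<integral>\<^sup>+t. ennreal (loss (W \<omega>) t) \<partial>\<mu>) \<partial>P) =
      (\<integral>\<^sup>+t. (\<integral>\<^sup>+\<omega>. ennreal (loss (W \<omega>) t) \<partial>P) \<partial>\<mu>)"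
    by (rule pp.Fubini'[symmetric]) measurable
  finally have "ennreal \<beta> + (\<integral>\<^sup>+\<omega>. ennreal ((norm (f0 - ewa (W \<omega>)))\<^sup>2) \<partial>P) \<le>
      ennreal \<beta> + ((\<integral>\<^sup>+t. (\<integral>\<^sup>+\<omega>. ennreal (loss (W \<omega>) t) \<partial>P) \<partial>\<mu>) + q)"
    by (simp add: nn_integral_add P.emeasure_space_1)
  then show ?thesis
    unfolding ennreal_add_left_cancel_le by (simp add: q_def add.assoc)
qed

end

theorem theorem4p2:
  fixes P :: "'w measure"
    and M :: "'t measure"
    and W :: "'w \<Rightarrow> real^'n"
    and f0 b :: "real^'n"
    and A :: "'t \<Rightarrow> real^'n^'n"
    and bt :: "'t \<Rightarrow> real^'n"
    and pen :: "'t \<Rightarrow> real"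
    and \<pi> :: "'t measure"
    and \<sigma> \<beta> :: real
  assumes "prob_space P"
    and "centred_subgaussian P W \<sigma>"
    and "\<pi> \<in> space (prob_algebra M)"
    and "A \<in> borel_measurable M"
    and "bt \<in> borel_measurable M"
    and "pen \<in> borel_measurable M"
    and "\<forall>t\<in>space M. psd_matrix (A t)"
    and "(SUP t\<in>space M. ereal (onorm ((*v) (A t)))) \<le> 1"
    and "\<beta> > 4 * \<sigma>\<^sup>2"
    and "\<forall>t\<in>space M. pen t \<ge> 4 * \<sigma>\<^sup>2 / (\<beta> - 4 * \<sigma>\<^sup>2) *
           (\<sigma>\<^sup>2 * trace (A t ** A t) + 2 * bias_term (space M) A b bt f0 t)"
  shows
    "(\<forall>\<eta>\<in>{0<..1}.
        \<P>(\<omega> in P.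
          ennreal ((norm (f0 - f_EWA \<sigma> \<beta> \<pi> A b bt pen (f0 + W \<omega>)))\<^sup>2)
          \<le> (INF \<mu>\<in>space (prob_algebra M).
               (\<integral>\<^sup>+t. ennreal ((norm (f0 - affine_estimator A b bt t (f0 + W \<omega>)))\<^sup>2) \<partial>\<mu>)
             + (\<integral>\<^sup>+t. ennreal (pen t + 2 * \<sigma>\<^sup>2 * trace (A t)
                   + 8 * \<sigma>\<^sup>2 / (\<beta> - 4 * \<sigma>\<^sup>2) * bias_term (space M) A b bt f0 t) \<partial>\<mu>)
             + ennreal \<beta> * (2 * KL \<mu> \<pi> + ennreal (ln (1 / \<eta>)))))
        \<ge> 1 - \<eta>)
     \<and>
     (\<integral>\<^sup>+\<omega>. ennreal ((norm (f0 - f_EWA \<sigma> \<beta> \<pi> A b bt pen (f0 + W \<omega>)))\<^sup>2) \<partial>P)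
       \<le> (INF \<mu>\<in>space (prob_algebra M).
            (\<integral>\<^sup>+t. (\<integral>\<^sup>+\<omega>. ennreal ((norm (f0 - affine_estimator A b bt t (f0 + W \<omega>)))\<^sup>2) \<partial>P) \<partial>\<mu>)
          + (\<integral>\<^sup>+t. ennreal (pen t + 2 * \<sigma>\<^sup>2 * trace (A t)
                + 8 * \<sigma>\<^sup>2 / (\<beta> - 4 * \<sigma>\<^sup>2) * bias_term (space M) A b bt f0 t) \<partial>\<mu>)
          + 2 * ennreal \<beta> * KL \<mu> \<pi>)"
proof -
  interpret penalized_affine_aggregation P M W f0 b A bt pen \<pi> \<sigma> \<beta>
    using assms by (rule penalized_affine_aggregation.intro)
  show ?thesis
    using oracle_inequality_in_probability oracle_inequality_in_expectation
    unfolding loss_def price_def comparison_price_def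
    by (intro conjI ballI INF_greatest) auto
qed

end
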